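(* Let $q$ be a prime power. Let $c_A(n,q)$ (resp. $c_{GL}(n,q)$) be the proportion of cyclic elements in $A(n,q)$ (resp. $GL(n,q)$), $C_A(u,q)=\sum_{n\ge0}c_A(n,q)u^n$ and $C_{GL}(u,q)=\sum_{n\ge0}c_{GL}(n,q)u^n$. Then as formal power series \[ C_A(u,q)=\frac{1}{1-u/q}\prod_{d\ge1}\Bigl(1+\frac{u^d}{(q^d-1)(1-u^d/q^d)}\Bigr)^{N'(d,q)}=\frac{1}{1-u/q}\cdot\frac{1}{1+\frac{u}{(q-1)(1-u/q)}}\,C_{GL}(u,q). \]
   Context: $A(n,q)$ is the group of matrices $x\in GL(n+1,q)$ with $x_{11}=1$ and $x_{j1}=0$ for $j\ge2$, viewed in $GL(n+1,q)$. A matrix is cyclic if its minimal polynomial equals its characteristic polynomial. $GL(0,q)$ is trivial, $c_{GL}(0,q)=1$. $N(d,q)$ is the number of monic irreducible polynomials of degree $d$ over $\mathbb{F}_q$; $N'(d,q)=N(d,q)$ for $d>1$ and $N'(1,q)=q-2$. *)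

theory Defs
  imports "Jordan_Normal_Form.Char_Poly"
          "HOL-Computational_Algebra.Formal_Power_Series"
begin

definition mat_poly_eval :: "'a :: comm_ring_1 poly \<Rightarrow> 'a mat \<Rightarrow> 'a mat" where
  "mat_poly_eval p A =
     foldr (\<lambda>i M. M + coeff p i \<cdot>\<^sub>m (A ^\<^sub>m i)) [0..<Suc (degree p)] (0\<^sub>m (dim_row A) (dim_row A))"

definition is_minimal_poly :: "'a :: field mat \<Rightarrow> 'a poly \<Rightarrow> bool" where
  "is_minimal_poly A p \<longleftrightarrow>
     monic p \<and> mat_poly_eval p A = 0\<^sub>m (dim_row A) (dim_row A) \<and>
     (\<forall>r. r \<noteq> 0 \<and> mat_poly_eval r A = 0\<^sub>m (dim_row A) (dim_row A) \<longrightarrow> degree p \<le> degree r)"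

definition cyclic_mat :: "'a :: field mat \<Rightarrow> bool" where
  "cyclic_mat A \<longleftrightarrow> is_minimal_poly A (char_poly A)"

definition GL_set :: "nat \<Rightarrow> 'a :: field mat set" where
  "GL_set n = {x \<in> carrier_mat n n. det x \<noteq> 0}"

text \<open>A(n,q) inside GL(n+1,q) (indices are 0-based: x_{11} is entry (0,0)).\<close>
definition A_set :: "nat \<Rightarrow> 'a :: field mat set" where
  "A_set n = {x \<in> GL_set (Suc n). x $$ (0,0) = 1 \<and> (\<forall>j\<in>{1..n}. x $$ (j,0) = 0)}"

definition cGL :: "'a :: {finite,field} itself \<Rightarrow> nat \<Rightarrow> real" where
  "cGL T n = real (card {x \<in> (GL_set n :: 'a mat set). cyclic_mat x}) / real (card (GL_set n :: 'a mat set))"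

definition cA :: "'a :: {finite,field} itself \<Rightarrow> nat \<Rightarrow> real" where
  "cA T n = real (card {x \<in> (A_set n :: 'a mat set). cyclic_mat x}) / real (card (A_set n :: 'a mat set))"

definition CGL :: "'a :: {finite,field} itself \<Rightarrow> real fps" where
  "CGL T = Abs_fps (cGL T)"

definition CA :: "'a :: {finite,field} itself \<Rightarrow> real fps" where
  "CA T = Abs_fps (cA T)"

definition Nirr :: "'a :: {finite,field} itself \<Rightarrow> nat \<Rightarrow> nat" where
  "Nirr T d = card {p :: 'a poly. monic p \<and> irreducible p \<and> degree p = d}"

definition Nirr' :: "'a :: {finite,field} itself \<Rightarrow> nat \<Rightarrow> nat" where
  "Nirr' T d = (if d = 1 then card (UNIV :: 'a set) - 2 else Nirr T d)"

end

theory Submission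
  imports Defs "HOL-Library.Cardinality"
begin

text \<open>
  Let \<open>\<Phi>(f)\<close> be the number of units of \<open>F[t]/(f)\<close>. A cyclic matrix with characteristic polynomial \<open>f\<close>
  has exactly \<open>\<Phi>(f)\<close> cyclic vectors, and sending a pair \<open>(A, v)\<close> with \<open>v\<close> cyclic for \<open>A\<close> to the matrix
  \<open>P\<close> with columns \<open>v, A v, A\<^sup>2 v, \<dots>\<close> is a bijection onto \<open>GL(n,q)\<close>, since \<open>A P = P C\<close> for the
  companion matrix \<open>C\<close> of \<open>f\<close>. Hence \<open>c\<^sub>G\<^sub>L(n)\<close> is the sum of \<open>1/\<Phi>(f)\<close> over monic \<open>f\<close> of degree
  \<open>n\<close> with \<open>f(0) \<noteq> 0\<close>. Membership in \<open>A(n,q)\<close> means that \<open>A\<close> fixes \<open>e\<^sub>0\<close>, i.e. that \<open>P\<close> maps one of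
  the \<open>q - 1\<close> nonzero fixed vectors of \<open>C\<close> to \<open>e\<^sub>0\<close>; this gives \<open>c\<^sub>A(n)\<close> as the sum of
  \<open>(q-1)/\<Phi>(f)\<close> over \<open>f\<close> of degree \<open>n + 1\<close> with \<open>f(0) \<noteq> 0\<close> and \<open>f(1) = 0\<close>. As \<open>\<Phi>\<close> is
  multiplicative, both generating functions are Euler products over the irreducible polynomials; for
  \<open>A(n,q)\<close> the factor \<open>E\<close> at \<open>t - 1\<close> is replaced by \<open>(q - 1)(E - 1)/u = 1/(1 - u/q)\<close>.
\<close>

section \<open>Arithmetic of polynomials over a field\<close>

text \<open>For a fixed monic \<open>f\<close> of degree \<open>n\<close> the count is the same
  whatever the factorisation of \<open>f\<close>: every invertible \<open>P\<close> comes from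
  exactly one pair, and the cyclic vectors of a given \<open>A\<close> are the \<open>h(A) v\<close>
  with \<open>h\<close> a unit modulo \<open>f\<close>. The delicate point is that a matrix whose
  minimal polynomial has degree \<open>n\<close> possesses a cyclic vector at all. The infinite
  product is reached only through finite ones. A prime of degree above \<open>n\<close> cannot
  influence the coefficient of u^n, so partial products over degrees up to \<open>D\<close> have the
  right coefficient once \<open>D >= n\<close>; for A(n,q), whose characteristic polynomials have
  degree n + 1, the comparison is made at \<open>D >= n + 1\<close>. The value N'(1,q) = q - 2
  arises because two monic linear polynomials are set aside: t, excluded by invertibility, and t -
  1, whose factor is treated apart. In (q - 1)(E - 1)/u the -1 removes the polynomials that do not
  vanish at 1, the factor q - 1 counts the nonzero fixed vectors of \<open>C\<close>, and the
  division by u is the shift from degree n + 1 to index n.\<close>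

lemma coprime_poly_bezout:
  fixes a b :: "'a :: field poly"
  assumes "coprime a b"
  obtains x y where "x * a + y * b = 1"
proof -
  have "\<exists>x y. x * a + y * b = 1" using assms
  \<comment> \<open>The measure separates 0 from the nonzero constants, which \<open>degree\<close>
    does not: the last Euclidean step goes from a constant \<open>b\<close> to remainder 0.\<close>
  proof (induction "if b = 0 then 0 else Suc (degree b)" arbitrary: a b rule: less_induct)
    case less
    show ?case
    proof (cases "b = 0")
      case True
      then have "is_unit a" using less.prems by simp
      then obtain c where "1 = a * c" by (elim dvdE)
      then have "c * a + 0 * b = 1" by (simp add: mult.commute)
      then show ?thesis by blast
    next
      case False
      have cop: "coprime b (a mod b)"
      proof (rule coprimeI)
        fix c assume c: "c dvd b" "c dvd a mod b"
        then have "c dvd a" by (simp add: dvd_mod_iff)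
        with c less.prems show "is_unit c" by (metis coprime_common_divisor)
      qed
      have lt: "(if a mod b = 0 then 0 else Suc (degree (a mod b))) < (if b = 0 then 0 else Suc (degree b))"
        using False degree_mod_less'[of b a] by auto
      obtain x y where "x * b + y * (a mod b) = 1" using less.hyps[OF lt cop] by blast
      moreover have "a mod b = a - (a div b) * b" by (simp add: minus_div_mult_eq_mod)
      ultimately have "y * a + (x - y * (a div b)) * b = 1" by (simp add: algebra_simps)
      then show ?thesis by blast
    qed
  qed
  then show ?thesis using that by blast
qed

lemma coprime_poly_dvd_mult_cancel:
  fixes a b c :: "'a :: field poly"
  assumes "coprime a b" "a dvd b * c"
  shows "a dvd c"
proof -
  obtain x y where "x * a + y * b = 1" using coprime_poly_bezout[OF assms(1)] .
  then have "c = (x * a + y * b) * c" by simp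
  also have "\<dots> = x * c * a + y * (b * c)" by (simp add: algebra_simps)
  finally show ?thesis using assms(2) by (metis dvd_add dvd_mult dvd_triv_right)
qed

lemma coprime_poly_mult_dvd:
  fixes a b c :: "'a :: field poly"
  assumes "coprime a b" "a dvd c" "b dvd c"
  shows "a * b dvd c"
proof -
  obtain d where d: "c = b * d" using assms(3) by (elim dvdE)
  then have "a dvd d" using coprime_poly_dvd_mult_cancel assms by blast
  then show ?thesis using d by (simp add: mult.commute mult_dvd_mono)
qed

lemma coprime_poly_mult_left_iff:
  fixes a b c :: "'a :: field poly"
  shows "coprime (a * b) c \<longleftrightarrow> coprime a c \<and> coprime b c"
proof
  assume "coprime (a * b) c"
  then show "coprime a c \<and> coprime b c"
    by (meson coprime_divisors dvd_refl dvd_triv_left dvd_triv_right)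
next
  assume *: "coprime a c \<and> coprime b c"
  show "coprime (a * b) c"
  proof (rule coprimeI)
    fix d assume d: "d dvd a * b" "d dvd c"
    then have "coprime d a" using * by (meson coprime_divisors dvd_refl coprime_commute)
    then have "d dvd b" using d coprime_poly_dvd_mult_cancel by blast
    with d * show "is_unit d" by (meson coprime_common_divisor)
  qed
qed

lemma coprime_poly_power_left:
  fixes a c :: "'a :: field poly"
  assumes "coprime a c"
  shows "coprime (a ^ k) c"
  using assms by (induction k) (simp_all add: coprime_poly_mult_left_iff)

lemma coprime_irreducible_poly_iff:
  fixes p h :: "'a :: field poly"
  assumes "irreducible p"
  shows "coprime p h \<longleftrightarrow> \<not> p dvd h"
proof
  show "\<not> p dvd h" if "coprime p h"
    using that assms by (metis coprime_common_divisor dvd_refl irreducible_not_unit)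
  show "coprime p h" if "\<not> p dvd h"
  proof (rule coprimeI)
    fix c assume c: "c dvd p" "c dvd h"
    then obtain e where "p = c * e" by (elim dvdE)
    then have "is_unit c \<or> is_unit e" using assms irreducibleD by blast
    moreover have "\<not> is_unit e"
      using \<open>p = c * e\<close> c that by (metis mult_unit_dvd_iff)
    ultimately show "is_unit c" by blast
  qed
qed

lemma monic_dvd_antisym:
  fixes p q :: "'a :: field poly"
  assumes "monic p" "monic q" "p dvd q" "q dvd p"
  shows "p = q"
proof -
  obtain c where c: "q = p * c" using assms(3) by (elim dvdE)
  have "p \<noteq> 0" "q \<noteq> 0" using assms by auto
  then have "degree p = degree q" using assms by (simp add: dvd_imp_degree_le le_antisym)
  moreover have "c \<noteq> 0" "p \<noteq> 0" using c assms by auto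
  ultimately have "degree c = 0" using c by (simp add: degree_mult_eq)
  then obtain k where k: "c = [:k:]" by (elim degree_eq_zeroE)
  have "lead_coeff q = lead_coeff p * lead_coeff c" by (simp add: c lead_coeff_mult)
  then have "k = 1" using assms k by simp
  then show ?thesis using c k by (simp add: one_pCons[symmetric])
qed

lemma monic_irreducible_dvd_imp_eq:
  fixes p q :: "'a :: field poly"
  assumes "monic p" "monic q" "irreducible p" "irreducible q" "p dvd q"
  shows "p = q"
proof -
  obtain c where c: "q = p * c" using assms(5) by (elim dvdE)
  then have "is_unit c" using assms by (metis irreducibleD irreducible_not_unit)
  then have "q dvd p" using c by (simp add: mult_unit_dvd_iff)
  then show ?thesis using monic_dvd_antisym assms by blast
qed

lemma monic_one_degree_0:
  fixes f :: "'a :: field poly"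
  assumes "monic f" "degree f = 0"
  shows "f = 1"
  using assms by (metis coeff_pCons_0 degree_eq_zeroE one_pCons)

section \<open>Residues modulo a polynomial and the totient\<close>

definition residue_polys :: "'a :: field poly \<Rightarrow> 'a poly set" where
  "residue_polys f = {h. h mod f = h}"

definition coprime_residues :: "'a :: field poly \<Rightarrow> 'a poly set" where
  "coprime_residues f = {h \<in> residue_polys f. coprime f h}"

definition poly_totient :: "'a :: field poly \<Rightarrow> nat" where
  "poly_totient f = card (coprime_residues f)"

text \<open>The case \<open>h = 0\<close> stands apart because \<open>degree 0 = 0\<close>: for a
  nonzero constant \<open>f\<close> no degree lies below \<open>degree f\<close>, yet 0 is a
  residue.\<close>

lemma residue_polys_iff:
  assumes "f \<noteq> 0"
  shows "h \<in> residue_polys f \<longleftrightarrow> h = 0 \<or> degree h < degree f"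
  using degree_mod_less[OF assms, of h] mod_poly_less[of h f] by (auto simp: residue_polys_def)

lemma residue_polys_coeff_iff:
  assumes "f \<noteq> 0"
  shows "h \<in> residue_polys f \<longleftrightarrow> (\<forall>i\<ge>degree f. coeff h i = 0)"
proof
  assume "h \<in> residue_polys f"
  then show "\<forall>i\<ge>degree f. coeff h i = 0"
    unfolding residue_polys_iff[OF assms] by (auto intro: coeff_eq_0)
next
  assume "\<forall>i\<ge>degree f. coeff h i = 0"
  then show "h \<in> residue_polys f"
    unfolding residue_polys_iff[OF assms] using leading_coeff_0_iff not_le by metis
qed

lemma coeff_bounded_polys_bij:
  "bij_betw (\<lambda>xs. Poly xs) {xs :: 'a :: zero list. length xs = n} {h. \<forall>i\<ge>n. coeff h i = 0}"
proof (rule bij_betwI[where g = "\<lambda>h. map (coeff h) [0..<n]"])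
  show "(\<lambda>xs. Poly xs) \<in> {xs. length xs = n} \<rightarrow> {h. \<forall>i\<ge>n. coeff h i = 0}"
    by (auto simp: nth_default_def)
  show "map (coeff (Poly xs)) [0..<n] = xs" if "xs \<in> {xs. length xs = n}" for xs :: "'a list"
    using that by (auto intro!: nth_equalityI simp: nth_default_def)
  show "Poly (map (coeff h) [0..<n]) = h" if "h \<in> {h. \<forall>i\<ge>n. coeff h i = 0}" for h :: "'a poly"
    using that by (auto intro!: poly_eqI simp: nth_default_def)
qed auto

text \<open>Bounding the coefficients instead of the degree makes \<open>n = 0\<close> give the zero
  polynomial alone, so the power of the field size is right without exception.\<close>

lemma finite_card_coeff_bounded_polys:
  shows "finite {h :: 'a :: {finite,zero} poly. \<forall>i\<ge>n. coeff h i = 0}"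
    and "card {h :: 'a :: {finite,zero} poly. \<forall>i\<ge>n. coeff h i = 0} = CARD('a) ^ n"
  using coeff_bounded_polys_bij[of n, where 'a = 'a]
    finite_lists_length_eq[of "UNIV :: 'a set" n] card_lists_length_eq[of "UNIV :: 'a set" n]
  by (auto dest: bij_betw_finite bij_betw_same_card)

lemma finite_residue_polys:
  fixes f :: "'a :: {finite,field} poly"
  assumes "f \<noteq> 0"
  shows "finite (residue_polys f)" "card (residue_polys f) = CARD('a) ^ degree f"
proof -
  have "residue_polys f = {h. \<forall>i\<ge>degree f. coeff h i = 0}"
    using residue_polys_coeff_iff[OF assms] by blast
  then show "finite (residue_polys f)" "card (residue_polys f) = CARD('a) ^ degree f"
    using finite_card_coeff_bounded_polys by auto
qed

lemma finite_polys_of_degree: "finite {f :: 'a :: {finite,zero} poly. degree f = n}"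
  by (rule finite_subset[OF _ finite_card_coeff_bounded_polys(1)[of "Suc n"]])
     (auto intro: coeff_eq_0)

lemma finite_polys_degree_le: "finite {f :: 'a :: {finite,zero} poly. degree f \<le> n}"
  by (rule finite_subset[OF _ finite_card_coeff_bounded_polys(1)[of "Suc n"]])
     (auto intro: coeff_eq_0)

text \<open>Divisors of \<open>g\<close> divide \<open>f\<close> as well, so they do not notice
  reduction modulo \<open>f\<close>. A proper divisor \<open>g\<close> is what the Chinese remainder
  argument uses.\<close>

lemma coprime_mod_right_iff:
  fixes f h :: "'a :: field poly"
  assumes "g dvd f"
  shows "coprime g (h mod f) \<longleftrightarrow> coprime g h"
proof -
  have "c dvd h mod f \<longleftrightarrow> c dvd h" if "c dvd g" for c
    using that assms by (meson dvd_mod_iff dvd_trans)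
  then show ?thesis by (auto simp: coprime_def)
qed

text \<open>The zero ring has one unit: its only residue 0 is coprime to 1. This value is the
  constant term of every Euler factor.\<close>

lemma poly_totient_1: "poly_totient (1 :: 'a :: field poly) = 1"
proof -
  have "coprime_residues (1 :: 'a poly) = {0}"
    by (auto simp: coprime_residues_def residue_polys_def)
  then show ?thesis by (simp add: poly_totient_def)
qed

lemma poly_totient_pos:
  fixes f :: "'a :: {finite,field} poly"
  assumes "f \<noteq> 0"
  shows "poly_totient f > 0"
proof -
  \<comment> \<open>The witness is \<open>1 mod f\<close> because 1 itself is not a residue when
    \<open>f\<close> is constant.\<close>
  have "1 mod f \<in> coprime_residues f"
    using coprime_mod_right_iff[of f f 1] by (auto simp: coprime_residues_def residue_polys_def)
  moreover have "finite (coprime_residues f)"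
    using finite_residue_polys(1)[OF assms] by (simp add: coprime_residues_def)
  ultimately show ?thesis unfolding poly_totient_def by (auto simp: card_gt_0_iff)
qed

lemma mod_poly_eq_iff:
  fixes f a b :: "'a :: field poly"
  shows "a mod f = b mod f \<longleftrightarrow> f dvd a - b"
  by (simp add: mod_eq_dvd_iff)

text \<open>Chinese remainder theorem, restricted to units: reduction modulo \<open>f\<close> and
  \<open>g\<close> matches the residues coprime to \<open>f * g\<close> with pairs of coprime
  residues.\<close>

lemma poly_totient_mult_coprime:
  fixes f g :: "'a :: {finite,field} poly"
  assumes "coprime f g"
  shows "poly_totient (f * g) = poly_totient f * poly_totient g"
proof -
  have "bij_betw (\<lambda>h. (h mod f, h mod g)) (coprime_residues (f * g))
          (coprime_residues f \<times> coprime_residues g)"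
  proof (rule bij_betw_imageI)
    show "inj_on (\<lambda>h. (h mod f, h mod g)) (coprime_residues (f * g))"
    proof (rule inj_onI)
      fix a b assume ab: "a \<in> coprime_residues (f * g)" "b \<in> coprime_residues (f * g)"
        and "(a mod f, a mod g) = (b mod f, b mod g)"
      then have "f * g dvd a - b" using assms by (simp add: mod_poly_eq_iff coprime_poly_mult_dvd)
      then have "a mod (f * g) = b mod (f * g)" by (simp add: mod_poly_eq_iff)
      then show "a = b" using ab by (simp add: coprime_residues_def residue_polys_def)
    qed
    show "(\<lambda>h. (h mod f, h mod g)) ` coprime_residues (f * g) = coprime_residues f \<times> coprime_residues g"
    proof (intro equalityI subsetI)
      fix z assume "z \<in> (\<lambda>h. (h mod f, h mod g)) ` coprime_residues (f * g)"
      then show "z \<in> coprime_residues f \<times> coprime_residues g"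
        by (auto simp: coprime_residues_def residue_polys_def coprime_mod_right_iff
            coprime_poly_mult_left_iff)
    next
      fix z assume "z \<in> coprime_residues f \<times> coprime_residues g"
      then obtain a b where z: "z = (a, b)" "a mod f = a" "b mod g = b" "coprime f a" "coprime g b"
        by (auto simp: coprime_residues_def residue_polys_def)
      obtain x y where xy: "x * f + y * g = 1" using coprime_poly_bezout[OF assms] .
      \<comment> \<open>By Bezout \<open>y * g\<close> is 1 modulo \<open>f\<close> and 0 modulo
        \<open>g\<close>, and \<open>x * f\<close> the reverse.\<close>
      define h where "h = a * (y * g) + b * (x * f)"
      have "h - a = (b - a) * x * f" "h - b = (a - b) * y * g"
        using arg_cong[OF xy, of "\<lambda>t. a * t"] arg_cong[OF xy, of "\<lambda>t. b * t"]
        by (simp_all add: h_def algebra_simps)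
      then have h: "h mod f = a" "h mod g = b"
        using z by (metis mod_poly_eq_iff dvd_triv_right)+
      have "coprime f h" "coprime g h"
        using h z coprime_mod_right_iff[of f f h] coprime_mod_right_iff[of g g h] by auto
      then have "h mod (f * g) \<in> coprime_residues (f * g)"
        by (simp add: coprime_residues_def residue_polys_def coprime_mod_right_iff
            coprime_poly_mult_left_iff)
      moreover have "(h mod (f * g)) mod f = a" "(h mod (f * g)) mod g = b"
        using h by (simp_all add: mod_mod_cancel)
      ultimately show "z \<in> (\<lambda>h. (h mod f, h mod g)) ` coprime_residues (f * g)"
        using z by (auto intro!: image_eqI[of _ _ "h mod (f * g)"])
    qed
  qed
  then show ?thesis by (simp add: poly_totient_def bij_betw_same_card card_cartesian_product[symmetric])
qed

text \<open>The residues modulo \<open>p ^ Suc k\<close> that are not units are the multiples of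
  \<open>p\<close>, that is \<open>p\<close> times the residues modulo \<open>p ^ k\<close>. The sum
  form avoids subtraction on the naturals.\<close>

lemma poly_totient_power:
  fixes p :: "'a :: {finite,field} poly"
  assumes "irreducible p"
  shows "poly_totient (p ^ Suc k) + CARD('a) ^ (degree p * k) = CARD('a) ^ (degree p * Suc k)"
proof -
  have p0: "p \<noteq> 0" using assms by auto
  have cop: "coprime (p ^ Suc k) h \<longleftrightarrow> \<not> p dvd h" for h
    using coprime_irreducible_poly_iff[OF assms, of h] coprime_poly_power_left[of p h k]
    by (auto simp: coprime_poly_mult_left_iff)
  have nc: "{h \<in> residue_polys (p ^ Suc k). p dvd h} = (\<lambda>h. p * h) ` residue_polys (p ^ k)"
  proof (intro equalityI subsetI)
    fix h assume "h \<in> {h \<in> residue_polys (p ^ Suc k). p dvd h}"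
    then have "p dvd h" and hm: "h mod (p ^ Suc k) = h" by (auto simp: residue_polys_def)
    then obtain h' where "h = p * h'" by (elim dvdE)
    with hm have "h = p * h'" "(p * h') mod (p ^ Suc k) = p * h'" by blast+
    then show "h \<in> (\<lambda>h. p * h) ` residue_polys (p ^ k)"
      using p0 by (auto simp: residue_polys_def mult_mod_right[symmetric])
  next
    fix h assume "h \<in> (\<lambda>h. p * h) ` residue_polys (p ^ k)"
    then show "h \<in> {h \<in> residue_polys (p ^ Suc k). p dvd h}"
      by (auto simp: residue_polys_def mult_mod_right[symmetric])
  qed
  have fin: "finite (residue_polys (p ^ Suc k))" using p0 by (intro finite_residue_polys) simp
  have "residue_polys (p ^ Suc k) = coprime_residues (p ^ Suc k) \<union> {h \<in> residue_polys (p ^ Suc k). p dvd h}"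
    by (auto simp: coprime_residues_def cop simp del: power_Suc)
  then have "card (residue_polys (p ^ Suc k)) =
      card (coprime_residues (p ^ Suc k) \<union> {h \<in> residue_polys (p ^ Suc k). p dvd h})" by simp
  also have "\<dots> = poly_totient (p ^ Suc k) + card {h \<in> residue_polys (p ^ Suc k). p dvd h}"
    unfolding poly_totient_def using fin
    by (intro card_Un_disjoint) (auto simp: coprime_residues_def cop simp del: power_Suc)
  also have "card {h \<in> residue_polys (p ^ Suc k). p dvd h} = card (residue_polys (p ^ k))"
    unfolding nc using p0 by (intro card_image) (auto simp: inj_on_def)
  finally show ?thesis
    using p0 finite_residue_polys(2)[of "p ^ k"] finite_residue_polys(2)[of "p ^ Suc k"]
    by (simp add: degree_power_eq degree_mult_eq algebra_simps)
qed

lemma poly_totient_power_real: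
  fixes p :: "'a :: {finite,field} poly"
  assumes "irreducible p"
  shows "real (poly_totient (p ^ Suc k)) =
    (real CARD('a) ^ degree p - 1) * (real CARD('a) ^ degree p) ^ k"
proof -
  have "real (poly_totient (p ^ Suc k)) + real CARD('a) ^ (degree p * k) = real CARD('a) ^ (degree p * Suc k)"
    using poly_totient_power[OF assms, of k] by (metis of_nat_add of_nat_power)
  moreover have "real CARD('a) ^ (degree p * k) = (real CARD('a) ^ degree p) ^ k"
    "real CARD('a) ^ (degree p * Suc k) = real CARD('a) ^ degree p * (real CARD('a) ^ degree p) ^ k"
    by (simp_all add: power_mult power_add)
  ultimately show ?thesis by (simp only: left_diff_distrib mult_1_left)
qed

section \<open>The finite Euler product\<close>

text \<open>The local factor at \<open>p\<close>. Exponents are stretched by \<open>degree p\<close>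
  so that a product of such series is graded by the total degree of the polynomial.\<close>

definition euler_factor :: "'a :: {finite,field} poly \<Rightarrow> real fps" where
  "euler_factor p = Abs_fps (\<lambda>m. if degree p dvd m
     then 1 / real (poly_totient (p ^ (m div degree p))) else 0)"

lemma card_field_ge_2: "CARD('a :: {finite,field}) \<ge> 2"
proof -
  have "card {0, 1 :: 'a} \<le> CARD('a)" by (intro card_mono) auto
  then show ?thesis by simp
qed

lemma irreducible_degree_pos:
  fixes p :: "'a :: field poly"
  assumes "irreducible p"
  shows "degree p > 0"
  using assms by (metis gr0I irreducible_def is_unit_iff_degree)

text \<open>After the constant term the nonzero coefficients are geometric with ratio
  \<open>1 / Q\<close>, where \<open>Q = q ^ degree p\<close>, because the totient of
  \<open>p ^ Suc k\<close> is \<open>(Q - 1) * Q ^ k\<close>. Multiplying by the denominator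
  \<open>G\<close> therefore leaves a single power of u.\<close>

lemma euler_factor_eq:
  fixes p :: "'a :: {finite,field} poly"
  defines "q \<equiv> real CARD('a)"
  assumes "irreducible p"
  shows "euler_factor p = 1 + fps_X ^ degree p *
    inverse (fps_const (q ^ degree p - 1) * (1 - fps_const (1 / q ^ degree p) * fps_X ^ degree p))"
proof -
  define d where "d = degree p"
  define Q where "Q = q ^ d"
  define G where "G = fps_const (Q - 1) * (1 - fps_const (1 / Q) * fps_X ^ d)"
  have d: "d > 0" using irreducible_degree_pos assms by (simp add: d_def)
  have "q > 1" using card_field_ge_2[where 'a='a] by (simp add: q_def)
  then have Q: "Q > 1" using d by (simp add: Q_def)
  have E: "fps_nth (euler_factor p - 1) n =
      (if n > 0 \<and> d dvd n then 1 / ((Q - 1) * Q ^ (n div d - 1)) else 0)" for n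
  proof (cases "n > 0 \<and> d dvd n")
    case True
    then have "n div d > 0" using d by (auto elim!: dvdE)
    then obtain k where k: "n div d = Suc k" using gr0_implies_Suc by blast
    have "real (poly_totient (p ^ Suc k)) = (Q - 1) * Q ^ k"
      using poly_totient_power_real[OF assms(2), of k] by (simp add: Q_def q_def d_def)
    then show ?thesis using True k by (simp add: euler_factor_def d_def del: power_Suc)
  next
    case False
    then show ?thesis by (auto simp: euler_factor_def d_def poly_totient_1)
  qed
  have "(euler_factor p - 1) * G = fps_X ^ d"
  proof (rule fps_ext)
    fix n
    have "(euler_factor p - 1) * G = fps_const (Q - 1) * ((euler_factor p - 1) -
        fps_const (1 / Q) * ((euler_factor p - 1) * fps_X ^ d))"
      by (simp add: G_def algebra_simps)
    then have "fps_nth ((euler_factor p - 1) * G) n = (Q - 1) * (fps_nth (euler_factor p - 1) n -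
        (1 / Q) * (if n < d then 0 else fps_nth (euler_factor p - 1) (n - d)))"
      by (simp add: fps_X_power_mult_right_nth)
    also have "\<dots> = (if n = d then 1 else 0)"
    proof -
      consider "n < d" | "n = d" | "n > d" by linarith
      then show ?thesis
      proof cases
        case 1
        then show ?thesis unfolding E by (auto dest: dvd_imp_le)
      next
        case 2
        then show ?thesis unfolding E using d Q by auto
      next
        case 3
        then obtain m where m: "n = d + m" "m > 0" using less_imp_add_positive by blast
        show ?thesis
        proof (cases "d dvd m")
          case True
          then obtain k where k: "m div d = Suc k"
            using m d by (metis dvd_div_eq_0_iff neq0_conv gr0_implies_Suc)
          then have "n div d = Suc (Suc k)" using m d by simp
          then show ?thesis unfolding E using True m k d Q by simp
        next
          case False
          then show ?thesis unfolding E using m d by simp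
        qed
      qed
    qed
    finally show "fps_nth ((euler_factor p - 1) * G) n = fps_nth (fps_X ^ d) n"
      by (simp add: fps_X_power_nth)
  qed
  moreover have "fps_nth G 0 \<noteq> 0" using Q d by (simp add: G_def)
  then have "G * inverse G = 1" by (simp add: inverse_mult_eq_1')
  ultimately have "euler_factor p - 1 = fps_X ^ d * inverse G"
    by (metis mult.assoc mult.right_neutral)
  then have "euler_factor p = 1 + fps_X ^ d * inverse G" by (simp add: algebra_simps)
  then show ?thesis by (simp add: G_def Q_def d_def)
qed

text \<open>Limiting the admissible primes to \<open>S\<close> turns the Euler product into an
  induction on a finite set, one prime at a time.\<close>

definition monic_polys_supported :: "'a :: field poly set \<Rightarrow> nat \<Rightarrow> 'a poly set" where
  "monic_polys_supported S n = {f. monic f \<and> degree f = n \<and>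
     (\<forall>p. monic p \<and> irreducible p \<and> p dvd f \<longrightarrow> p \<in> S)}"

lemma finite_monic_polys_supported:
  "finite (monic_polys_supported (S :: 'a :: {finite,field} poly set) n)"
  by (rule finite_subset[OF _ finite_polys_of_degree[of n]]) (auto simp: monic_polys_supported_def)

lemma monic_polys_supported_empty:
  "monic_polys_supported ({} :: 'a :: field poly set) n = (if n = 0 then {1} else {})"
proof -
  have "f = 1" if "f \<in> monic_polys_supported ({} :: 'a poly set) n" for f
  proof -
    have "degree f = 0"
    proof (rule ccontr)
      assume "degree f \<noteq> 0"
      then obtain p r where "irreducible p" "f = p * r" "monic p"
        using irreducible_monic_factor[of f] by auto
      then show False using that by (auto simp: monic_polys_supported_def)
    qed
    then show ?thesis using that monic_one_degree_0[of f] by (auto simp: monic_polys_supported_def)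
  qed
  moreover have "1 \<in> monic_polys_supported ({} :: 'a poly set) 0"
    using irreducible_not_unit by (auto simp: monic_polys_supported_def)
  moreover have "1 \<notin> monic_polys_supported ({} :: 'a poly set) n" if "n \<noteq> 0"
    using that by (simp add: monic_polys_supported_def)
  ultimately show ?thesis by (auto simp del: One_nat_def)
qed

lemma split_power_dvd:
  fixes p f :: "'a :: field poly"
  assumes "degree p > 0" "f \<noteq> 0"
  obtains k g where "f = p ^ k * g" "\<not> p dvd g"
proof -
  have "\<exists>k g. f = p ^ k * g \<and> \<not> p dvd g" using assms(2)
  proof (induction "degree f" arbitrary: f rule: less_induct)
    case less
    show ?case
    proof (cases "p dvd f")
      case True
      then obtain h where h: "f = p * h" by (elim dvdE)
      then have "h \<noteq> 0" "degree h < degree f"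
        using less.prems assms(1) by (auto simp: degree_mult_eq)
      then obtain k g where "h = p ^ k * g" "\<not> p dvd g" using less.hyps by blast
      then have "f = p ^ Suc k * g" "\<not> p dvd g" using h by simp_all
      then show ?thesis by blast
    next
      case False
      then have "f = p ^ 0 * f" by simp
      then show ?thesis using False by blast
    qed
  qed
  then show ?thesis using that by blast
qed

text \<open>If \<open>i\<close> exceeded \<open>j\<close>, cancelling \<open>p ^ j\<close> would
  leave a factor \<open>p\<close> in \<open>h\<close>. Used in both directions, this makes the
  exponent of \<open>p\<close> unique.\<close>

lemma power_mult_eq_imp_exponent_le:
  fixes p g h :: "'a :: idom"
  assumes "p \<noteq> 0" "p ^ i * g = p ^ j * h" "\<not> p dvd h"
  shows "i \<le> j"
proof (rule ccontr)
  assume "\<not> i \<le> j"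
  then obtain k where "i = j + Suc k" using less_imp_Suc_add by fastforce
  then have "p ^ j * (p * (p ^ k * g)) = p ^ j * h" using assms(2) by (simp add: power_add algebra_simps)
  then have "h = p * (p ^ k * g)" using assms(1) by simp
  then show False using assms(3) by simp
qed

text \<open>Splitting off the full power of \<open>p\<close> is unique. The index \<open>i\<close>
  is the degree of that power and not its exponent, so that it can be the index of a Cauchy
  product.\<close>

lemma monic_polys_supported_insert_bij:
  fixes p :: "'a :: {finite,field} poly"
  assumes p: "monic p" "irreducible p" and S: "p \<notin> S"
  shows "bij_betw (\<lambda>(i, g). p ^ (i div degree p) * g)
    (SIGMA i:{i \<in> {0..n}. degree p dvd i}. monic_polys_supported S (n - i))
    (monic_polys_supported (insert p S) n)"
proof -
  define d where "d = degree p"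
  have d: "d > 0" using irreducible_degree_pos p by (simp add: d_def)
  have p0: "p \<noteq> 0" "\<not> is_unit p" using p by auto
  have ndvd: "\<not> p dvd g" if "g \<in> monic_polys_supported S m" for g m
    using that p S by (auto simp: monic_polys_supported_def)
  show ?thesis
  proof (rule bij_betw_imageI)
    show "inj_on (\<lambda>(i, g). p ^ (i div degree p) * g)
        (SIGMA i:{i \<in> {0..n}. degree p dvd i}. monic_polys_supported S (n - i))"
    proof (rule inj_onI, clarsimp simp: d_def[symmetric])
      fix i g j h
      assume ij: "d dvd i" "d dvd j" and g: "g \<in> monic_polys_supported S (n - i)"
        and h: "h \<in> monic_polys_supported S (n - j)"
        and eq: "p ^ (i div d) * g = p ^ (j div d) * h"
      have "i div d = j div d"
        using power_mult_eq_imp_exponent_le[OF p0(1) eq ndvd[OF h]]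
          power_mult_eq_imp_exponent_le[OF p0(1) eq[symmetric] ndvd[OF g]] by simp
      then show "i = j \<and> g = h" using ij eq p0 by (metis dvd_div_mult_self mult_left_cancel power_not_zero)
    qed
    show "(\<lambda>(i, g). p ^ (i div degree p) * g) `
        (SIGMA i:{i \<in> {0..n}. degree p dvd i}. monic_polys_supported S (n - i)) =
        monic_polys_supported (insert p S) n"
    proof (intro equalityI subsetI)
      fix f assume "f \<in> (\<lambda>(i, g). p ^ (i div degree p) * g) `
        (SIGMA i:{i \<in> {0..n}. degree p dvd i}. monic_polys_supported S (n - i))"
      then obtain i g where ig: "i \<le> n" "d dvd i" "g \<in> monic_polys_supported S (n - i)"
        and f: "f = p ^ (i div d) * g" by (auto simp: d_def)
      have g0: "monic g" "degree g = n - i" using ig by (auto simp: monic_polys_supported_def)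
      then have "g \<noteq> 0" by auto
      then have "degree f = n"
        using f ig g0 p0 by (simp add: degree_mult_eq degree_power_eq d_def[symmetric])
      moreover have "monic f" using f g0 p by (simp add: lead_coeff_mult monic_power)
      moreover have "r \<in> insert p S" if r: "monic r" "irreducible r" "r dvd f" for r
      proof (cases "r dvd g")
        case True
        then show ?thesis using r ig by (auto simp: monic_polys_supported_def)
      next
        case False
        then have "\<not> coprime r (p ^ (i div d))"
          using r f coprime_poly_dvd_mult_cancel by blast
        then have "r dvd p"
          using coprime_irreducible_poly_iff[OF r(2)] coprime_poly_power_left
          by (metis coprime_commute)
        then show ?thesis using monic_irreducible_dvd_imp_eq r p by blast
      qed
      ultimately show "f \<in> monic_polys_supported (insert p S) n"
        by (auto simp: monic_polys_supported_def)
    next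
      fix f assume f: "f \<in> monic_polys_supported (insert p S) n"
      then have f0: "monic f" "degree f = n" "f \<noteq> 0" by (auto simp: monic_polys_supported_def)
      obtain k g where g: "f = p ^ k * g" "\<not> p dvd g"
        using split_power_dvd[of p f] d f0 unfolding d_def by blast
      define i where "i = d * k"
      have g0: "g \<noteq> 0" using g by auto
      have "degree f = i + degree g"
        by (subst g(1)) (use g0 p0 in \<open>simp add: degree_mult_eq degree_power_eq i_def d_def\<close>)
      moreover have "lead_coeff f = lead_coeff g"
        using arg_cong[OF g(1), of lead_coeff] p by (simp add: lead_coeff_mult monic_power)
      moreover have "r \<in> S" if "monic r" "irreducible r" "r dvd g" for r
      proof -
        have "r dvd f" using that g(1) by (metis dvd_mult)
        then have "r \<in> insert p S" using f that by (auto simp: monic_polys_supported_def)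
        then show ?thesis using g(2) that by auto
      qed
      ultimately have "i \<le> n" "g \<in> monic_polys_supported S (n - i)"
        using f0 by (auto simp: monic_polys_supported_def)
      moreover have "f = p ^ (i div d) * g" "d dvd i" using g(1) d by (simp_all add: i_def)
      ultimately show "f \<in> (\<lambda>(i, g). p ^ (i div degree p) * g) `
        (SIGMA i:{i \<in> {0..n}. degree p dvd i}. monic_polys_supported S (n - i))"
        unfolding d_def by (intro image_eqI[of _ _ "(i, g)"]) auto
    qed
  qed
qed

text \<open>Inserting a prime multiplies the series by its local factor. Multiplicativity of the
  totient merges the two reciprocals, and the preceding bijection re-indexes the Cauchy
  product.\<close>

lemma prod_euler_factor_nth:
  fixes S :: "'a :: {finite,field} poly set"
  assumes "finite S" "\<And>p. p \<in> S \<Longrightarrow> monic p \<and> irreducible p"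
  shows "fps_nth (\<Prod>p\<in>S. euler_factor p) n =
    (\<Sum>f\<in>monic_polys_supported S n. 1 / real (poly_totient f))"
  using assms
proof (induction S arbitrary: n rule: finite_induct)
  case empty
  then show ?case by (simp add: monic_polys_supported_empty poly_totient_1)
next
  case (insert p S)
  have p: "monic p" "irreducible p" using insert.prems by auto
  have IH: "fps_nth (\<Prod>p\<in>S. euler_factor p) n =
    (\<Sum>f\<in>monic_polys_supported S n. 1 / real (poly_totient f))" for n
    using insert by auto
  have tot: "poly_totient (p ^ k * g) = poly_totient (p ^ k) * poly_totient g"
    if "g \<in> monic_polys_supported S m" for k g m
  proof (rule poly_totient_mult_coprime)
    have "\<not> p dvd g" using that p insert.hyps by (auto simp: monic_polys_supported_def)
    then show "coprime (p ^ k) g"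
      using coprime_irreducible_poly_iff p coprime_poly_power_left by blast
  qed
  let ?I = "{i \<in> {0..n}. degree p dvd i}"
  have "fps_nth (\<Prod>p\<in>insert p S. euler_factor p) n =
      (\<Sum>i=0..n. fps_nth (euler_factor p) i * (\<Sum>g\<in>monic_polys_supported S (n - i). 1 / real (poly_totient g)))"
    using insert.hyps by (simp add: fps_mult_nth IH)
  also have "\<dots> = (\<Sum>i\<in>?I. fps_nth (euler_factor p) i * (\<Sum>g\<in>monic_polys_supported S (n - i). 1 / real (poly_totient g)))"
    by (rule sum.mono_neutral_right) (auto simp: euler_factor_def)
  also have "\<dots> = (\<Sum>i\<in>?I. \<Sum>g\<in>monic_polys_supported S (n - i). 1 / real (poly_totient (p ^ (i div degree p) * g)))"
    by (intro sum.cong refl) (simp add: euler_factor_def sum_distrib_left tot)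
  also have "\<dots> = (\<Sum>(i, g)\<in>(SIGMA i:?I. monic_polys_supported S (n - i)). 1 / real (poly_totient (p ^ (i div degree p) * g)))"
    by (subst sum.Sigma) (auto simp: finite_monic_polys_supported)
  also have "\<dots> = (\<Sum>f\<in>monic_polys_supported (insert p S) n. 1 / real (poly_totient f))"
    using sum.reindex_bij_betw[OF monic_polys_supported_insert_bij[OF p insert.hyps(2), of n],
        of "\<lambda>f. 1 / real (poly_totient f)"]
    by (simp add: case_prod_unfold)
  finally show ?case .
qed

section \<open>Polynomials acting on vectors\<close>

lemma foldr_add_mat_carrier:
  assumes "\<And>i. i \<in> set xs \<Longrightarrow> M i \<in> carrier_mat n n"
  shows "foldr (\<lambda>i N. N + M i) xs (0\<^sub>m n n) \<in> carrier_mat n n"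
  using assms by (induction xs) auto

lemma foldr_add_mat_index:
  assumes "\<And>i. i \<in> set xs \<Longrightarrow> M i \<in> carrier_mat n n" "r < n" "c < n"
  shows "foldr (\<lambda>i N. N + M i) xs (0\<^sub>m n n) $$ (r, c) = (\<Sum>i\<leftarrow>xs. M i $$ (r, c) :: 'a :: comm_ring_1)"
  using assms
proof (induction xs)
  case (Cons x xs)
  have "foldr (\<lambda>i N. N + M i) xs (0\<^sub>m n n) \<in> carrier_mat n n"
    using Cons.prems by (intro foldr_add_mat_carrier) auto
  moreover have "M x \<in> carrier_mat n n" using Cons.prems by simp
  ultimately have "(foldr (\<lambda>i N. N + M i) xs (0\<^sub>m n n) + M x) $$ (r, c) =
      foldr (\<lambda>i N. N + M i) xs (0\<^sub>m n n) $$ (r, c) + M x $$ (r, c)"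
    using Cons.prems by (intro index_add_mat) auto
  then show ?case using Cons by (simp add: add.commute)
qed simp

lemma mat_poly_eval_carrier:
  assumes "A \<in> carrier_mat n n"
  shows "mat_poly_eval p A \<in> carrier_mat n n"
  unfolding mat_poly_eval_def carrier_matD(1)[OF assms]
  by (rule foldr_add_mat_carrier) (use assms in auto)

text \<open>The free bound \<open>N\<close> lets polynomials of different degrees be compared over
  one range of summation.\<close>

lemma mat_poly_eval_index:
  assumes "A \<in> carrier_mat n n" "r < n" "c < n" "degree p < N"
  shows "mat_poly_eval p A $$ (r, c) = (\<Sum>i<N. coeff p i * (A ^\<^sub>m i) $$ (r, c))"
proof -
  have "mat_poly_eval p A $$ (r, c) = (\<Sum>i\<leftarrow>[0..<Suc (degree p)]. (coeff p i \<cdot>\<^sub>m (A ^\<^sub>m i)) $$ (r, c))"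
    unfolding mat_poly_eval_def carrier_matD(1)[OF assms(1)]
    by (rule foldr_add_mat_index) (use assms in auto)
  also have "\<dots> = (\<Sum>i<Suc (degree p). (coeff p i \<cdot>\<^sub>m (A ^\<^sub>m i)) $$ (r, c))"
    by (simp only: interv_sum_list_conv_sum_set_nat set_upt lessThan_atLeast0)
  also have "\<dots> = (\<Sum>i<Suc (degree p). coeff p i * (A ^\<^sub>m i) $$ (r, c))"
    using assms by (intro sum.cong) auto
  also have "\<dots> = (\<Sum>i<N. coeff p i * (A ^\<^sub>m i) $$ (r, c))"
    using assms(4) by (intro sum.mono_neutral_left) (auto simp: coeff_eq_0)
  finally show ?thesis .
qed

text \<open>In this form the bound may be 0 when \<open>p = 0\<close>, where
  \<open>degree p < N\<close> fails; this covers matrices of dimension 0.\<close>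

lemma mat_poly_eval_index_coeff:
  assumes "A \<in> carrier_mat n n" "r < n" "c < n" "\<And>k. k \<ge> N \<Longrightarrow> coeff p k = 0"
  shows "mat_poly_eval p A $$ (r, c) = (\<Sum>i<N. coeff p i * (A ^\<^sub>m i) $$ (r, c))"
proof -
  have "mat_poly_eval p A $$ (r, c) = (\<Sum>i<N + Suc (degree p). coeff p i * (A ^\<^sub>m i) $$ (r, c))"
    using assms by (intro mat_poly_eval_index) auto
  also have "\<dots> = (\<Sum>i<N. coeff p i * (A ^\<^sub>m i) $$ (r, c))"
    using assms(4) by (intro sum.mono_neutral_right) auto
  finally show ?thesis .
qed

lemma mat_poly_eval_0 [simp]:
  assumes "A \<in> carrier_mat n n"
  shows "mat_poly_eval 0 A = 0\<^sub>m n n"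
  using assms mat_poly_eval_carrier[OF assms, of 0]
  by (intro eq_matI) (simp_all add: mat_poly_eval_index[of A n _ _ 0 1])

lemma mat_poly_eval_add:
  assumes "A \<in> carrier_mat n n"
  shows "mat_poly_eval (p + q) A = mat_poly_eval p A + mat_poly_eval q A"
proof (rule eq_matI)
  define N where "N = Suc (max (degree p) (degree q))"
  have N: "degree (p + q) < N" "degree p < N" "degree q < N"
    by (auto simp: N_def less_Suc_eq_le intro: degree_add_le)
  fix i j assume "i < dim_row (mat_poly_eval p A + mat_poly_eval q A)"
    "j < dim_col (mat_poly_eval p A + mat_poly_eval q A)"
  then have ij: "i < n" "j < n" using mat_poly_eval_carrier[OF assms, of q] by auto
  have "mat_poly_eval (p + q) A $$ (i, j) = mat_poly_eval p A $$ (i, j) + mat_poly_eval q A $$ (i, j)"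
    using N by (simp add: mat_poly_eval_index[OF assms ij, of _ N] sum.distrib algebra_simps)
  then show "mat_poly_eval (p + q) A $$ (i, j) = (mat_poly_eval p A + mat_poly_eval q A) $$ (i, j)"
    using ij mat_poly_eval_carrier[OF assms, of q] by auto
qed (use mat_poly_eval_carrier[OF assms, of "p + q"] mat_poly_eval_carrier[OF assms, of q] in auto)

lemma mat_poly_eval_smult:
  assumes "A \<in> carrier_mat n n"
  shows "mat_poly_eval (Polynomial.smult a p) A = a \<cdot>\<^sub>m mat_poly_eval p A"
proof (rule eq_matI)
  fix i j assume "i < dim_row (a \<cdot>\<^sub>m mat_poly_eval p A)" "j < dim_col (a \<cdot>\<^sub>m mat_poly_eval p A)"
  then have ij: "i < n" "j < n" using mat_poly_eval_carrier[OF assms, of p] by auto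
  have "degree (Polynomial.smult a p) < Suc (degree p)" using degree_smult_le[of a p] by simp
  then have "mat_poly_eval (Polynomial.smult a p) A $$ (i, j) = a * mat_poly_eval p A $$ (i, j)"
    using mat_poly_eval_index[OF assms ij, of "Polynomial.smult a p" "Suc (degree p)"]
      mat_poly_eval_index[OF assms ij, of p "Suc (degree p)"]
    by (simp only: sum_distrib_left coeff_smult mult.assoc lessI)
  then show "mat_poly_eval (Polynomial.smult a p) A $$ (i, j) = (a \<cdot>\<^sub>m mat_poly_eval p A) $$ (i, j)"
    using ij mat_poly_eval_carrier[OF assms, of p] by auto
qed (use mat_poly_eval_carrier[OF assms, of p] mat_poly_eval_carrier[OF assms, of "Polynomial.smult a p"] in auto)

lemma pow_mat_Suc_left:
  assumes "A \<in> carrier_mat n n"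
  shows "A ^\<^sub>m Suc k = A * A ^\<^sub>m k"
proof (induction k)
  case (Suc k)
  have "A ^\<^sub>m k \<in> carrier_mat n n" using assms by simp
  then show ?case using Suc assms by (metis assoc_mult_mat pow_mat.simps(2))
qed (use assms in simp)

text \<open>Horner's rule. It drives the \<open>pCons\<close> induction by which products of
  polynomials become composed actions in \<open>poly_act_mult\<close>.\<close>

lemma mat_poly_eval_pCons:
  assumes "A \<in> carrier_mat n n"
  shows "mat_poly_eval (pCons a p) A = a \<cdot>\<^sub>m 1\<^sub>m n + A * mat_poly_eval p A"
proof (rule eq_matI)
  note car = mat_poly_eval_carrier[OF assms]
  fix i j assume "i < dim_row (a \<cdot>\<^sub>m 1\<^sub>m n + A * mat_poly_eval p A)"
    "j < dim_col (a \<cdot>\<^sub>m 1\<^sub>m n + A * mat_poly_eval p A)"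
  then have ij: "i < n" "j < n" using car[of p] assms by auto
  define N where "N = Suc (degree p)"
  have N: "degree p < N" "degree (pCons a p) < Suc N" by (auto simp: N_def degree_pCons_le less_Suc_eq_le)
  have pw: "A ^\<^sub>m k \<in> carrier_mat n n" for k using assms by simp
  have A: "dim_row A = n" "dim_col A = n" using assms by auto
  have "(A * mat_poly_eval p A) $$ (i, j) = (\<Sum>l<n. A $$ (i, l) * mat_poly_eval p A $$ (l, j))"
    using ij assms car[of p] by (simp add: scalar_prod_def lessThan_atLeast0)
  also have "\<dots> = (\<Sum>l<n. A $$ (i, l) * (\<Sum>k<N. coeff p k * (A ^\<^sub>m k) $$ (l, j)))"
    using ij N by (intro sum.cong) (auto simp: mat_poly_eval_index[OF assms])
  also have "\<dots> = (\<Sum>k<N. \<Sum>l<n. A $$ (i, l) * (coeff p k * (A ^\<^sub>m k) $$ (l, j)))"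
    by (subst sum.swap) (simp add: sum_distrib_left)
  also have "\<dots> = (\<Sum>k<N. coeff p k * (\<Sum>l<n. A $$ (i, l) * (A ^\<^sub>m k) $$ (l, j)))"
    by (simp add: sum_distrib_left mult_ac)
  also have "\<dots> = (\<Sum>k<N. coeff p k * (A ^\<^sub>m Suc k) $$ (i, j))"
    using ij pw unfolding pow_mat_Suc_left[OF assms]
    by (intro sum.cong refl) (simp add: A scalar_prod_def lessThan_atLeast0)
  finally have 1: "(A * mat_poly_eval p A) $$ (i, j) = (\<Sum>k<N. coeff p k * (A ^\<^sub>m Suc k) $$ (i, j))" .
  have "mat_poly_eval (pCons a p) A $$ (i, j) = a * (1\<^sub>m n) $$ (i, j) + (\<Sum>k<N. coeff p k * (A ^\<^sub>m Suc k) $$ (i, j))"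
    using mat_poly_eval_index[OF assms ij N(2)] A
    by (simp add: sum.lessThan_Suc_shift del: pow_mat.simps(2) sum.lessThan_Suc)
  then show "mat_poly_eval (pCons a p) A $$ (i, j) = (a \<cdot>\<^sub>m 1\<^sub>m n + A * mat_poly_eval p A) $$ (i, j)"
    using ij 1 A car[of p] by (simp del: index_mult_mat(1))
qed (use assms mat_poly_eval_carrier[OF assms, of p] mat_poly_eval_carrier[OF assms, of "pCons a p"] in auto)

text \<open>The F[t]-module structure on vectors in which t acts as \<open>A\<close>.\<close>

definition poly_act :: "'a :: comm_ring_1 mat \<Rightarrow> 'a poly \<Rightarrow> 'a vec \<Rightarrow> 'a vec" where
  "poly_act A p v = mat_poly_eval p A *\<^sub>v v"

context
  fixes A :: "'a :: comm_ring_1 mat" and n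
  assumes A: "A \<in> carrier_mat n n"
begin

lemma zero_smult_vec_carrier: "v \<in> carrier_vec n \<Longrightarrow> (0 :: 'a) \<cdot>\<^sub>v v = 0\<^sub>v n"
  by (auto intro!: eq_vecI)

lemma mult_mat_zero_vec: "A *\<^sub>v 0\<^sub>v n = 0\<^sub>v n"
  using A by (auto intro!: eq_vecI)

lemma poly_act_carrier [simp]: "poly_act A p v \<in> carrier_vec n"
  unfolding poly_act_def
  by (rule carrier_vecI) (simp add: carrier_matD(1)[OF mat_poly_eval_carrier[OF A]])

lemma poly_act_0 [simp]: "v \<in> carrier_vec n \<Longrightarrow> poly_act A 0 v = 0\<^sub>v n"
  unfolding poly_act_def mat_poly_eval_0[OF A] by auto

lemma poly_act_zero_vec [simp]: "poly_act A p (0\<^sub>v n) = 0\<^sub>v n"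
  unfolding poly_act_def using mat_poly_eval_carrier[OF A, of p] by auto

lemma poly_act_add:
  "v \<in> carrier_vec n \<Longrightarrow> poly_act A (p + q) v = poly_act A p v + poly_act A q v"
  unfolding poly_act_def mat_poly_eval_add[OF A]
  by (rule add_mult_distrib_mat_vec) (rule mat_poly_eval_carrier[OF A] | assumption)+

lemma poly_act_add_vec:
  "v \<in> carrier_vec n \<Longrightarrow> w \<in> carrier_vec n \<Longrightarrow> poly_act A p (v + w) = poly_act A p v + poly_act A p w"
  unfolding poly_act_def using mat_poly_eval_carrier[OF A] by (intro mult_add_distrib_mat_vec) auto

lemma poly_act_smult:
  "v \<in> carrier_vec n \<Longrightarrow> poly_act A (Polynomial.smult a p) v = a \<cdot>\<^sub>v poly_act A p v"
  unfolding poly_act_def mat_poly_eval_smult[OF A]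
  using mat_poly_eval_carrier[OF A, of p] by (auto intro!: eq_vecI simp: scalar_prod_def sum_distrib_left mult_ac)

lemma poly_act_pCons:
  assumes "v \<in> carrier_vec n"
  shows "poly_act A (pCons a p) v = a \<cdot>\<^sub>v v + A *\<^sub>v poly_act A p v"
proof -
  note car = mat_poly_eval_carrier[OF A, of p]
  have "poly_act A (pCons a p) v = (a \<cdot>\<^sub>m 1\<^sub>m n) *\<^sub>v v + (A * mat_poly_eval p A) *\<^sub>v v"
    unfolding poly_act_def mat_poly_eval_pCons[OF A] using A assms car
    by (intro add_mult_distrib_mat_vec) auto
  also have "(a \<cdot>\<^sub>m 1\<^sub>m n) *\<^sub>v v = a \<cdot>\<^sub>v v" using assms by (auto intro!: eq_vecI)
  also have "(A * mat_poly_eval p A) *\<^sub>v v = A *\<^sub>v poly_act A p v"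
    unfolding poly_act_def using A assms car by (intro assoc_mult_mat_vec) auto
  finally show ?thesis .
qed

lemma poly_act_mult:
  assumes "v \<in> carrier_vec n"
  shows "poly_act A (p * q) v = poly_act A p (poly_act A q v)"
proof (induction p)
  case 0
  then show ?case using assms by simp
next
  case (pCons a p)
  then show ?case
    using A by (simp add: assms poly_act_add poly_act_smult poly_act_pCons zero_smult_vec_carrier)
qed

lemma poly_act_mult_commute:
  "v \<in> carrier_vec n \<Longrightarrow> poly_act A p (poly_act A q v) = poly_act A q (poly_act A p v)"
  by (metis poly_act_mult mult.commute)

lemma poly_act_1 [simp]: "v \<in> carrier_vec n \<Longrightarrow> poly_act A 1 v = v"
  unfolding one_pCons by (simp add: poly_act_pCons mult_mat_zero_vec)

lemma poly_act_const: "v \<in> carrier_vec n \<Longrightarrow> poly_act A [:c:] v = c \<cdot>\<^sub>v v"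
  by (simp add: poly_act_pCons mult_mat_zero_vec)

lemma poly_act_sum_coeffs:
  assumes "v \<in> carrier_vec n" "\<And>k. k \<ge> N \<Longrightarrow> coeff p k = 0" "i < n"
  shows "poly_act A p v $ i = (\<Sum>k<N. coeff p k * (A ^\<^sub>m k *\<^sub>v v) $ i)"
proof -
  note car = mat_poly_eval_carrier[OF A, of p]
  have pw: "A ^\<^sub>m k \<in> carrier_mat n n" for k using A by simp
  have dm: "dim_row A = n" "dim_col A = n" using A by auto
  have "poly_act A p v $ i = (\<Sum>j<n. mat_poly_eval p A $$ (i, j) * v $ j)"
    unfolding poly_act_def using car assms by (simp add: scalar_prod_def lessThan_atLeast0)
  also have "\<dots> = (\<Sum>j<n. (\<Sum>k<N. coeff p k * (A ^\<^sub>m k) $$ (i, j)) * v $ j)"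
    using assms mat_poly_eval_index_coeff[OF A, of i _ N p] by (intro sum.cong refl) simp
  also have "\<dots> = (\<Sum>k<N. coeff p k * (\<Sum>j<n. (A ^\<^sub>m k) $$ (i, j) * v $ j))"
    by (simp add: sum_distrib_left sum_distrib_right mult_ac) (rule sum.swap)
  also have "\<dots> = (\<Sum>k<N. coeff p k * (A ^\<^sub>m k *\<^sub>v v) $ i)"
    using assms pw by (intro sum.cong refl) (simp add: dm scalar_prod_def lessThan_atLeast0)
  finally show ?thesis .
qed

end

section \<open>Cyclic vectors and companion matrices\<close>

text \<open>Multiplication by t on F[t]/(f) in the basis 1, t, ..., t^(n-1), acting on
  columns.\<close>

definition companion_mat :: "nat \<Rightarrow> 'a :: field poly \<Rightarrow> 'a mat" where
  "companion_mat n f = mat n n (\<lambda>(i, j). if Suc j = n then - coeff f i else if i = Suc j then 1 else 0)"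

lemma companion_mat_carrier [simp]: "companion_mat n f \<in> carrier_mat n n"
  by (simp add: companion_mat_def)

text \<open>Left multiplication of \<open>t I - C\<close> by the unipotent matrix with first row \<open>1, t, \<dots>, t^(n-1)\<close>
  clears the first row except for its last entry, which becomes \<open>f\<close>.\<close>
lemma char_poly_companion_mat:
  fixes f :: "'a :: field poly"
  assumes "monic f" "degree f = n"
  shows "char_poly (companion_mat n f) = f"
proof (cases n)
  case 0
  then have "f = 1" using assms monic_one_degree_0 by blast
  moreover have "char_poly (companion_mat n f) = 1"
    unfolding char_poly_def using 0 by (intro det_dim_zero) auto
  ultimately show ?thesis by simp
next
  case (Suc m)
  define C where "C = companion_mat n f"
  define M where "M = char_poly_matrix C"
  define L :: "'a poly mat" where
    "L = mat n n (\<lambda>(i, j). if i = 0 then monom 1 j else if i = j then 1 else 0)"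
  define B where "B = L * M"
  have C: "C \<in> carrier_mat n n" by (simp add: C_def)
  have M: "M \<in> carrier_mat n n" using C by (simp add: M_def)
  have L: "L \<in> carrier_mat n n" by (simp add: L_def)
  have B: "B \<in> carrier_mat n n" using L M by (simp add: B_def)
  have Mij: "M $$ (i, j) = (if i = j then [:0, 1:] else 0) + [:- (C $$ (i, j)):]" if "i < n" "j < n" for i j
    using that C by (simp add: M_def char_poly_matrix_def)
  have mX: "monom 1 k * [:0, 1:] = (monom 1 (Suc k) :: 'a poly)" for k by (simp add: monom_Suc)
  have mC: "monom 1 k * [:c:] = (monom c k :: 'a poly)" for k c by (simp add: smult_monom)
  have m1: "[:- 1:] = (- 1 :: 'a poly)" by (simp only: one_pCons minus_pCons minus_zero)
  have BS: "B $$ (i, j) = M $$ (i, j)" if "i < n" "j < n" "i \<noteq> 0" for i j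
  proof -
    have "B $$ (i, j) = (\<Sum>k<n. L $$ (i, k) * M $$ (k, j))"
      unfolding B_def using that L M by (simp add: scalar_prod_def lessThan_atLeast0)
    also have "\<dots> = (\<Sum>k<n. if k = i then M $$ (k, j) else 0)"
      using that by (intro sum.cong refl) (auto simp: L_def)
    finally show ?thesis using that by simp
  qed
  have B0: "B $$ (0, j) = (if j = m then f else 0)" if "j < n" for j
  proof -
    have "B $$ (0, j) = (\<Sum>k<n. L $$ (0, k) * M $$ (k, j))"
      unfolding B_def using that L M Suc by (simp add: scalar_prod_def lessThan_atLeast0)
    also have "\<dots> = (\<Sum>k<n. (if k = j then monom 1 (Suc k) else 0) + monom (- (C $$ (k, j))) k)"
      using that by (intro sum.cong refl) (auto simp: L_def Mij mX mC distrib_left simp del: mult_pCons_right)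
    also have "\<dots> = monom 1 (Suc j) + (\<Sum>k<n. monom (- (C $$ (k, j))) k)"
      using that by (simp add: sum.distrib)
    also have "\<dots> = (if j = m then f else 0)"
    proof (cases "j = m")
      case True
      have "(\<Sum>k<n. monom (- (C $$ (k, j))) k) = (\<Sum>k<n. monom (coeff f k) k)"
        using True Suc by (intro sum.cong refl) (simp add: C_def companion_mat_def)
      moreover have "f = monom 1 (Suc m) + (\<Sum>k<n. monom (coeff f k) k)"
        using poly_as_sum_of_monoms[of f] assms Suc
        by (simp only: lessThan_Suc_atMost[symmetric] sum.lessThan_Suc add.commute)
      ultimately show ?thesis using True by simp
    next
      case False
      then have j: "Suc j < n" using that Suc by simp
      have "(\<Sum>k<n. monom (- (C $$ (k, j))) k) = (\<Sum>k<n. if k = Suc j then monom (- 1) k else 0)"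
        using False Suc that by (intro sum.cong refl) (auto simp: C_def companion_mat_def)
      also have "\<dots> = monom (- 1) (Suc j)" using j by simp
      finally show ?thesis using False by (simp add: add_monom)
    qed
    finally show ?thesis .
  qed
  have "det L = prod_list (diag_mat L)"
    by (rule det_upper_triangular[OF _ L]) (auto simp: L_def)
  also have "diag_mat L = replicate n 1"
    by (rule nth_equalityI) (auto simp: diag_mat_def L_def)
  finally have detL: "det L = 1" by simp
  \<comment> \<open>Only the last entry of the first row of \<open>B\<close> survives. Its minor is
    upper triangular with -1 on the diagonal, the former subdiagonal of \<open>t I - C\<close>, so
    its determinant cancels the sign of the cofactor.\<close>
  define D where "D = mat_delete B 0 m"
  have D: "D \<in> carrier_mat m m" using mat_delete_carrier[OF B, of 0 m] Suc by (simp add: D_def)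
  have Dij: "D $$ (i, j) = M $$ (Suc i, j)" if "i < m" "j < m" for i j
    using that B Suc BS[of "Suc i" j] by (simp add: D_def mat_delete_def)
  have "det D = prod_list (diag_mat D)"
    by (rule det_upper_triangular[OF _ D])
       (use D Suc in \<open>auto simp: Dij Mij C_def companion_mat_def\<close>)
  also have "diag_mat D = replicate m (- 1)"
    using D Suc by (intro nth_equalityI) (auto simp: diag_mat_def Dij Mij C_def companion_mat_def m1)
  finally have detD: "det D = (- 1) ^ m" by (simp add: prod_list_replicate)
  have "det M = det B" unfolding B_def det_mult[OF L M] detL by simp
  also have "\<dots> = (\<Sum>j<n. B $$ (0, j) * cofactor B 0 j)"
    using B Suc by (intro laplace_expansion_row) auto
  also have "\<dots> = (\<Sum>j<n. if j = m then f * cofactor B 0 j else 0)"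
    by (intro sum.cong refl) (auto simp: B0)
  also have "\<dots> = f * cofactor B 0 m" using Suc by simp
  also have "cofactor B 0 m = 1"
    unfolding cofactor_def D_def[symmetric] detD by (simp flip: power_mult_distrib)
  finally show ?thesis by (simp add: char_poly_def M_def C_def)
qed

lemma det_nonzero_inverse:
  fixes P :: "'a :: field mat"
  assumes "P \<in> carrier_mat n n" "det P \<noteq> 0"
  obtains Q where "Q \<in> carrier_mat n n" "P * Q = 1\<^sub>m n" "Q * P = 1\<^sub>m n"
  using det_non_zero_imp_unit[OF assms, of undefined]
  by (auto simp: Units_def ring_mat_def)

lemma det_nonzero_cancel_vec:
  fixes P :: "'a :: field mat"
  assumes "P \<in> carrier_mat n n" "det P \<noteq> 0" "x \<in> carrier_vec n" "y \<in> carrier_vec n"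
    "P *\<^sub>v x = P *\<^sub>v y"
  shows "x = y"
proof -
  obtain Q where Q: "Q \<in> carrier_mat n n" "Q * P = 1\<^sub>m n"
    using det_nonzero_inverse[OF assms(1,2)] by blast
  have *: "Q *\<^sub>v (P *\<^sub>v z) = z" if "z \<in> carrier_vec n" for z
    unfolding assoc_mult_mat_vec[OF Q(1) assms(1) that, symmetric] Q(2) using that by simp
  have "x = Q *\<^sub>v (P *\<^sub>v x)" by (rule *[OF assms(3), symmetric])
  also have "\<dots> = Q *\<^sub>v (P *\<^sub>v y)" by (simp only: assms(5))
  also have "\<dots> = y" by (rule *[OF assms(4)])
  finally show ?thesis .
qed

lemma mat_eq_0I:
  fixes M :: "'a :: field mat"
  assumes "M \<in> carrier_mat n n" "\<And>w. w \<in> carrier_vec n \<Longrightarrow> M *\<^sub>v w = 0\<^sub>v n"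
  shows "M = 0\<^sub>m n n"
proof (rule eq_matI)
  fix i j assume "i < dim_row (0\<^sub>m n n :: 'a mat)" "j < dim_col (0\<^sub>m n n :: 'a mat)"
  then have "i < n" "j < n" by auto
  then have "M $$ (i, j) = (M *\<^sub>v unit_vec n j) $ i" using assms(1) by simp
  then show "M $$ (i, j) = (0\<^sub>m n n :: 'a mat) $$ (i, j)" using assms \<open>i < n\<close> \<open>j < n\<close> by simp
qed (use assms in auto)

text \<open>Cyclicity is put as the absence of a relation of degree below the dimension; that the
  vectors \<open>A^j v\<close> span the space is then derived in
  \<open>cyclic_vec_generates\<close>.\<close>

definition cyclic_vec :: "'a :: field mat \<Rightarrow> 'a vec \<Rightarrow> bool" where
  "cyclic_vec A v \<longleftrightarrow> v \<in> carrier_vec (dim_row A) \<and>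
     (\<forall>p. p \<noteq> 0 \<and> poly_act A p v = 0\<^sub>v (dim_row A) \<longrightarrow> dim_row A \<le> degree p)"

definition krylov_mat :: "'a :: field mat \<Rightarrow> 'a vec \<Rightarrow> 'a mat" where
  "krylov_mat A v = mat (dim_row A) (dim_row A) (\<lambda>(i, j). (A ^\<^sub>m j *\<^sub>v v) $ i)"

context
  fixes A :: "'a :: field mat" and n
  assumes A: "A \<in> carrier_mat n n"
begin

lemma cyclic_vec_iff: "cyclic_vec A v \<longleftrightarrow> v \<in> carrier_vec n \<and>
    (\<forall>p. p \<noteq> 0 \<and> poly_act A p v = 0\<^sub>v n \<longrightarrow> n \<le> degree p)"
  unfolding cyclic_vec_def carrier_matD(1)[OF A] ..

lemma krylov_mat_carrier: "krylov_mat A v \<in> carrier_mat n n"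
  using A by (simp add: krylov_mat_def)

text \<open>For fixed \<open>v\<close> the action is linear in the coefficients, and its matrix has
  the columns \<open>A^j v\<close>. Relations of degree below \<open>n\<close> thus become kernel
  vectors of the Krylov matrix.\<close>

lemma poly_act_eq_krylov_mat:
  assumes "v \<in> carrier_vec n" "\<And>k. k \<ge> n \<Longrightarrow> coeff p k = 0"
  shows "poly_act A p v = krylov_mat A v *\<^sub>v vec n (coeff p)"
proof (rule eq_vecI)
  have dm: "dim_row A = n" "dim_col A = n" using A by auto
  fix i assume "i < dim_vec (krylov_mat A v *\<^sub>v vec n (coeff p))"
  then have i: "i < n" using A by (simp add: krylov_mat_def)
  have "poly_act A p v $ i = (\<Sum>k<n. coeff p k * (A ^\<^sub>m k *\<^sub>v v) $ i)"
    by (rule poly_act_sum_coeffs[OF A assms i])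
  also have "\<dots> = (krylov_mat A v *\<^sub>v vec n (coeff p)) $ i"
    using i dm by (simp add: krylov_mat_def scalar_prod_def lessThan_atLeast0 mult.commute)
  finally show "poly_act A p v $ i = (krylov_mat A v *\<^sub>v vec n (coeff p)) $ i" .
qed (use A in \<open>simp add: krylov_mat_def carrier_vecD[OF poly_act_carrier[OF A]]\<close>)

lemma poly_act_eq_krylov_mat_vec:
  assumes "v \<in> carrier_vec n" "w \<in> carrier_vec n"
  shows "poly_act A (Poly (list_of_vec w)) v = krylov_mat A v *\<^sub>v w"
proof -
  have "vec n (coeff (Poly (list_of_vec w))) = w"
    using assms(2) by (intro eq_vecI) (auto simp: nth_default_def list_of_vec_index)
  moreover have "coeff (Poly (list_of_vec w)) k = 0" if "k \<ge> n" for k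
    using that assms(2) by (simp add: nth_default_def)
  ultimately show ?thesis using poly_act_eq_krylov_mat[OF assms(1)] by metis
qed

lemma cyclic_vec_iff_det_krylov_mat:
  "cyclic_vec A v \<longleftrightarrow> v \<in> carrier_vec n \<and> det (krylov_mat A v) \<noteq> 0"
proof
  assume cyc: "cyclic_vec A v"
  then have v: "v \<in> carrier_vec n" unfolding cyclic_vec_iff by blast
  have "det (krylov_mat A v) \<noteq> 0"
  proof
    assume "det (krylov_mat A v) = 0"
    then obtain w where w: "w \<in> carrier_vec n" "w \<noteq> 0\<^sub>v n" "krylov_mat A v *\<^sub>v w = 0\<^sub>v n"
      using det_0_iff_vec_prod_zero_field[OF krylov_mat_carrier] by blast
    define p where "p = Poly (list_of_vec w)"
    have cw: "coeff p k = (if k < n then w $ k else 0)" for k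
      using w by (simp add: p_def nth_default_def list_of_vec_index)
    have "poly_act A p v = 0\<^sub>v n" using poly_act_eq_krylov_mat_vec[OF v w(1)] w by (simp add: p_def)
    then have "p = 0 \<or> n \<le> degree p" using cyc unfolding cyclic_vec_iff by blast
    \<comment> \<open>In the other case \<open>degree p >= n\<close>, and \<open>cw\<close> makes
      the leading coefficient 0.\<close>
    then have "p = 0" using cw[of "degree p"] by auto
    then have "w $ i = 0" if "i < n" for i using cw[of i] that by simp
    then have "w = 0\<^sub>v n" using w(1) by (intro eq_vecI) auto
    then show False using w by blast
  qed
  with v show "v \<in> carrier_vec n \<and> det (krylov_mat A v) \<noteq> 0" by blast
next
  assume *: "v \<in> carrier_vec n \<and> det (krylov_mat A v) \<noteq> 0"
  have "n \<le> degree p" if p: "p \<noteq> 0" "poly_act A p v = 0\<^sub>v n" for p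
  proof (rule ccontr)
    assume "\<not> n \<le> degree p"
    then have c: "\<And>k. k \<ge> n \<Longrightarrow> coeff p k = 0" by (auto intro: coeff_eq_0)
    have "krylov_mat A v *\<^sub>v vec n (coeff p) = 0\<^sub>v n"
      using poly_act_eq_krylov_mat[OF conjunct1[OF *] c] p(2) by simp
    then have "krylov_mat A v *\<^sub>v vec n (coeff p) = krylov_mat A v *\<^sub>v 0\<^sub>v n"
      by (simp only: mult_mat_zero_vec[OF krylov_mat_carrier])
    then have "vec n (coeff p) = 0\<^sub>v n"
      by (rule det_nonzero_cancel_vec[OF krylov_mat_carrier conjunct2[OF *] vec_carrier zero_carrier_vec])
    then have "vec n (coeff p) $ degree p = 0\<^sub>v n $ degree p" by simp
    then have "coeff p (degree p) = 0" using \<open>\<not> n \<le> degree p\<close> by simp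
    then show False using p by simp
  qed
  then show "cyclic_vec A v" using * unfolding cyclic_vec_iff by blast
qed

lemma cyclic_vec_generates:
  assumes "cyclic_vec A v" "w \<in> carrier_vec n"
  obtains p where "\<And>k. k \<ge> n \<Longrightarrow> coeff p k = 0" "poly_act A p v = w"
proof -
  have v: "v \<in> carrier_vec n" and d: "det (krylov_mat A v) \<noteq> 0"
    using assms cyclic_vec_iff_det_krylov_mat by auto
  obtain Q where Q: "Q \<in> carrier_mat n n" "krylov_mat A v * Q = 1\<^sub>m n"
    using det_nonzero_inverse[OF krylov_mat_carrier d] by blast
  define u where "u = Q *\<^sub>v w"
  have u: "u \<in> carrier_vec n" using Q assms by (simp add: u_def)
  have "krylov_mat A v *\<^sub>v u = (krylov_mat A v * Q) *\<^sub>v w"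
    unfolding u_def using assoc_mult_mat_vec[OF krylov_mat_carrier Q(1) assms(2)] by simp
  then have "poly_act A (Poly (list_of_vec u)) v = w"
    using Q assms poly_act_eq_krylov_mat_vec[OF v u] by simp
  moreover have "coeff (Poly (list_of_vec u)) k = 0" if "k \<ge> n" for k
    using that u by (simp add: nth_default_def)
  ultimately show ?thesis using that by blast
qed

lemma poly_act_uminus: "v \<in> carrier_vec n \<Longrightarrow> poly_act A (- p) v = - poly_act A p v"
  using poly_act_smult[OF A, of v "- 1" p] A by (auto intro!: eq_vecI simp: poly_act_def)

text \<open>Expressing \<open>A^n v\<close> in the basis \<open>v, ..., A^(n-1) v\<close> yields the
  relation. It is identified with the characteristic polynomial afterwards.\<close>

lemma cyclic_vec_relation:
  assumes "cyclic_vec A v"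
  obtains f where "monic f" "degree f = n" "poly_act A f v = 0\<^sub>v n"
proof -
  have v: "v \<in> carrier_vec n" using assms cyclic_vec_iff_det_krylov_mat by auto
  obtain p where p: "\<And>k. k \<ge> n \<Longrightarrow> coeff p k = 0" "poly_act A p v = poly_act A (monom 1 n) v"
    using cyclic_vec_generates[OF assms poly_act_carrier[OF A, of "monom 1 n" v]] by blast
  define f where "f = monom 1 n + (- p)"
  have cf: "coeff f n = 1" "\<And>k. k > n \<Longrightarrow> coeff f k = 0" using p by (auto simp: f_def)
  then have "degree f = n" by (intro antisym degree_le le_degree) auto
  moreover have "poly_act A f v = poly_act A (monom 1 n) v + - poly_act A p v"
    unfolding f_def poly_act_add[OF A v] poly_act_uminus[OF v] ..
  then have "poly_act A f v = 0\<^sub>v n"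
    unfolding p(2) by (simp add: uminus_r_inv_vec[OF poly_act_carrier[OF A]])
  ultimately show ?thesis using that cf by auto
qed

text \<open>Division by \<open>f\<close> leaves a remainder of degree below \<open>n\<close>, which
  cannot kill a cyclic vector unless it is 0. So the annihilator of \<open>v\<close> is the ideal
  (f).\<close>

lemma poly_act_cyclic_eq_0_iff:
  assumes "cyclic_vec A v" "monic f" "degree f = n" "poly_act A f v = 0\<^sub>v n"
  shows "poly_act A p v = 0\<^sub>v n \<longleftrightarrow> f dvd p"
proof -
  have v: "v \<in> carrier_vec n" using assms cyclic_vec_iff_det_krylov_mat by auto
  have mult: "poly_act A (f * r) v = 0\<^sub>v n" for r
    using poly_act_mult[OF A v, of r f] A by (simp add: mult.commute assms(4))
  have "f \<noteq> 0" using assms by auto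
  have "poly_act A p v = poly_act A (f * (p div f)) v + poly_act A (p mod f) v"
    using poly_act_add[OF A v, of "f * (p div f)" "p mod f"] by simp
  then have eq: "poly_act A p v = poly_act A (p mod f) v"
    using mult poly_act_carrier[OF A] by simp
  show ?thesis
  proof
    assume "poly_act A p v = 0\<^sub>v n"
    then have "p mod f = 0 \<or> n \<le> degree (p mod f)"
      using assms(1) unfolding cyclic_vec_iff eq by blast
    then show "f dvd p"
      using degree_mod_less[OF \<open>f \<noteq> 0\<close>, of p] assms(3) by auto
  qed (auto simp: mult elim: dvdE)
qed

text \<open>\<open>A\<close> moves each column \<open>A^j v\<close> to the next one, and the
  relation \<open>f\<close> rewrites \<open>A^n v\<close> in terms of the columns; multiplying by
  the companion matrix on the right does the same.\<close>

lemma mult_krylov_mat: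
  assumes "cyclic_vec A v" "monic f" "degree f = n" "poly_act A f v = 0\<^sub>v n"
  shows "A * krylov_mat A v = krylov_mat A v * companion_mat n f"
proof (rule eq_matI)
  have v: "v \<in> carrier_vec n" using assms cyclic_vec_iff_det_krylov_mat by auto
  have dm: "dim_row A = n" "dim_col A = n" using A by auto
  have K: "dim_row (krylov_mat A v) = n" "dim_col (krylov_mat A v) = n"
    using krylov_mat_carrier[of v] by auto
  fix i j assume "i < dim_row (krylov_mat A v * companion_mat n f)"
    "j < dim_col (krylov_mat A v * companion_mat n f)"
  then have ij: "i < n" "j < n" by (auto simp: K companion_mat_def)
  have pw: "A ^\<^sub>m k \<in> carrier_mat n n" for k using A by simp
  have "col (krylov_mat A v) j = A ^\<^sub>m j *\<^sub>v v"
    using ij v pw by (intro eq_vecI) (auto simp: krylov_mat_def dm)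
  then have "(A * krylov_mat A v) $$ (i, j) = (A *\<^sub>v (A ^\<^sub>m j *\<^sub>v v)) $ i"
    using ij by (simp add: dm K)
  also have "A *\<^sub>v (A ^\<^sub>m j *\<^sub>v v) = A ^\<^sub>m Suc j *\<^sub>v v"
    unfolding pow_mat_Suc_left[OF A] using assoc_mult_mat_vec[OF A pw v] by simp
  also have "\<dots> $ i = (krylov_mat A v * companion_mat n f) $$ (i, j)"
  proof (cases "Suc j = n")
    case True
    have "0 = (\<Sum>k<Suc n. coeff f k * (A ^\<^sub>m k *\<^sub>v v) $ i)"
      using poly_act_sum_coeffs[OF A v, of "Suc n" f i] assms ij by (simp add: coeff_eq_0)
    then have "(A ^\<^sub>m n *\<^sub>v v) $ i = - (\<Sum>k<n. coeff f k * (A ^\<^sub>m k *\<^sub>v v) $ i)"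
      using assms by (simp add: eq_neg_iff_add_eq_0 add.commute)
    also have "\<dots> = (\<Sum>k<n. krylov_mat A v $$ (i, k) * companion_mat n f $$ (k, j))"
      unfolding sum_negf[symmetric] using ij True
      by (intro sum.cong refl) (simp add: krylov_mat_def companion_mat_def dm)
    finally show ?thesis using ij True
      by (simp add: K scalar_prod_def lessThan_atLeast0 carrier_matD[OF companion_mat_carrier[of n f]])
  next
    case False
    have "(krylov_mat A v * companion_mat n f) $$ (i, j) =
        (\<Sum>k<n. krylov_mat A v $$ (i, k) * companion_mat n f $$ (k, j))"
      using ij by (simp add: K scalar_prod_def lessThan_atLeast0 carrier_matD[OF companion_mat_carrier[of n f]])
    also have "\<dots> = (\<Sum>k<n. if k = Suc j then krylov_mat A v $$ (i, k) else 0)"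
      using ij False by (intro sum.cong refl) (auto simp: companion_mat_def)
    also have "\<dots> = (A ^\<^sub>m Suc j *\<^sub>v v) $ i"
      using ij False by (simp add: krylov_mat_def dm del: pow_mat.simps)
    finally show ?thesis by simp
  qed
  finally show "(A * krylov_mat A v) $$ (i, j) = (krylov_mat A v * companion_mat n f) $$ (i, j)" .
qed (use A krylov_mat_carrier[of v] in \<open>auto simp: companion_mat_def\<close>)

text \<open>The Krylov matrix is invertible, so it conjugates the companion matrix of
  \<open>f\<close> to \<open>A\<close>, and similar matrices share their characteristic
  polynomial.\<close>

lemma char_poly_cyclic:
  assumes "cyclic_vec A v" "monic f" "degree f = n" "poly_act A f v = 0\<^sub>v n"
  shows "char_poly A = f"
proof -
  have d: "det (krylov_mat A v) \<noteq> 0" using assms cyclic_vec_iff_det_krylov_mat by auto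
  note K = krylov_mat_carrier[of v]
  obtain Q where Q: "Q \<in> carrier_mat n n" "krylov_mat A v * Q = 1\<^sub>m n" "Q * krylov_mat A v = 1\<^sub>m n"
    using det_nonzero_inverse[OF K d] .
  have "A = A * (krylov_mat A v * Q)" using A Q by simp
  also have "\<dots> = A * krylov_mat A v * Q" using assoc_mult_mat[OF A K Q(1)] by simp
  also have "\<dots> = krylov_mat A v * companion_mat n f * Q" unfolding mult_krylov_mat[OF assms] ..
  finally have "A = krylov_mat A v * companion_mat n f * Q" .
  then have "similar_mat_wit A (companion_mat n f) (krylov_mat A v) Q"
    by (rule similar_mat_witI[OF Q(2,3) _ A companion_mat_carrier K Q(1)])
  then have "similar_mat A (companion_mat n f)" unfolding similar_mat_def by blast
  then have "char_poly A = char_poly (companion_mat n f)" by (rule char_poly_similar)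
  then show ?thesis using char_poly_companion_mat[OF assms(2,3)] by simp
qed

text \<open>A relation of degree \<open>n\<close> exists and has just been seen to be
  \<open>char_poly A\<close>; this is Cayley-Hamilton on a cyclic vector.\<close>

lemma cyclic_vec_char_poly:
  assumes "cyclic_vec A v"
  shows "monic (char_poly A)" "degree (char_poly A) = n" "poly_act A (char_poly A) v = 0\<^sub>v n"
proof -
  obtain f where "monic f" "degree f = n" "poly_act A f v = 0\<^sub>v n"
    using cyclic_vec_relation[OF assms] by blast
  with char_poly_cyclic[OF assms] show "monic (char_poly A)" "degree (char_poly A) = n"
    "poly_act A (char_poly A) v = 0\<^sub>v n" by auto
qed

text \<open>A polynomial that kills \<open>v\<close> kills every \<open>p(A) v\<close>, hence the
  whole space; one of degree below \<open>n\<close> does not even kill \<open>v\<close>.\<close>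

lemma cyclic_vec_imp_cyclic_mat:
  assumes "cyclic_vec A v"
  shows "cyclic_mat A"
proof -
  note f = cyclic_vec_char_poly[OF assms]
  have v: "v \<in> carrier_vec n" using assms cyclic_vec_iff_det_krylov_mat by auto
  have dm: "dim_row A = n" using A by auto
  have "mat_poly_eval (char_poly A) A = 0\<^sub>m n n"
  proof (rule mat_eq_0I[OF mat_poly_eval_carrier[OF A]])
    fix w :: "'a vec" assume "w \<in> carrier_vec n"
    then obtain p where p: "poly_act A p v = w" using cyclic_vec_generates[OF assms] by blast
    have "poly_act A (char_poly A) w = 0\<^sub>v n"
      unfolding p[symmetric] using poly_act_mult_commute[OF A v, of "char_poly A" p] f A by simp
    then show "mat_poly_eval (char_poly A) A *\<^sub>v w = 0\<^sub>v n" by (simp add: poly_act_def)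
  qed
  moreover have "degree (char_poly A) \<le> degree r" if "r \<noteq> 0" "mat_poly_eval r A = 0\<^sub>m n n" for r
  proof -
    have "poly_act A r v = 0\<^sub>v n" unfolding poly_act_def that(2) using v by auto
    then show ?thesis using that assms f(2) unfolding cyclic_vec_iff by simp
  qed
  ultimately show ?thesis using f by (auto simp: cyclic_mat_def is_minimal_poly_def dm)
qed

end

section \<open>Existence and number of cyclic vectors\<close>

text \<open>Some prime has a higher exponent in \<open>b\<close> than in \<open>a\<close>. If a
  prime \<open>p\<close> of \<open>b\<close> is not one, its power is stripped from
  \<open>b\<close>: the rest is coprime to that power, so it still fails to divide \<open>a\<close>,
  and its degree is smaller.\<close>

lemma not_dvd_imp_prime_power:
  fixes a b :: "'a :: field poly"
  assumes "a \<noteq> 0" "b \<noteq> 0" "\<not> b dvd a"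
  obtains p i a' b' where "irreducible p" "a = p ^ i * a'" "\<not> p dvd a'" "b = p ^ Suc i * b'"
proof -
  have "\<exists>p i a' b'. irreducible p \<and> a = p ^ i * a' \<and> \<not> p dvd a' \<and> b = p ^ Suc i * b'"
    using assms(2,3)
  proof (induction "degree b" arbitrary: b rule: less_induct)
    case less
    have "degree b > 0"
    proof (rule ccontr)
      assume "\<not> degree b > 0"
      then have "is_unit b" using less.prems by (simp add: is_unit_iff_degree)
      then show False using less.prems by (blast intro: unit_imp_dvd)
    qed
    then obtain p r where p: "irreducible p" and pr: "b = p * r"
      using irreducible_monic_factor by blast
    have dp: "degree p > 0" by (rule irreducible_degree_pos[OF p])
    obtain i a' where a: "a = p ^ i * a'" "\<not> p dvd a'" using split_power_dvd[OF dp assms(1)] .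
    obtain j b' where b: "b = p ^ j * b'" "\<not> p dvd b'" using split_power_dvd[OF dp less.prems(1)] .
    show ?case
    proof (cases "i < j")
      case True
      then obtain k where "j = Suc i + k" using less_iff_Suc_add by auto
      then have "b = p ^ Suc i * (p ^ k * b')" using b(1) by (simp only: power_add mult.assoc)
      then show ?thesis using p a by blast
    next
      case False
      have "j \<noteq> 0"
      proof
        assume "j = 0"
        then have "b = b'" using b(1) by simp
        then show False using b(2) pr dvd_triv_left[of p r] by simp
      qed
      have b0: "b' \<noteq> 0" "p \<noteq> 0" using b(2) p by auto
      have "degree b = j * degree p + degree b'"
        using b0 by (subst b(1)) (simp add: degree_mult_eq degree_power_eq)
      then have lt: "degree b' < degree b" using \<open>j \<noteq> 0\<close> dp by simp
      have "\<not> b' dvd a"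
      proof
        assume "b' dvd a"
        moreover have "p ^ j dvd a" using a(1) False by (simp add: le_imp_power_dvd)
        moreover have "coprime (p ^ j) b'"
          using coprime_irreducible_poly_iff[OF p] b(2) coprime_poly_power_left by blast
        ultimately have "b dvd a" unfolding b(1) by (intro coprime_poly_mult_dvd)
        then show False using less.prems by blast
      qed
      then obtain p' i' a'' b'' where "irreducible p'" "a = p' ^ i' * a''" "\<not> p' dvd a''" "b' = p' ^ Suc i' * b''"
        using less.hyps[OF lt b0(1)] by blast
      moreover have "b = p' ^ Suc i' * (p ^ j * b'')" if "b' = p' ^ Suc i' * b''" for b''
        unfolding b(1) that by (simp only: ac_simps)
      ultimately show ?thesis by blast
    qed
  qed
  then show ?thesis using that by blast
qed

text \<open>The polynomials killing \<open>v\<close> form an ideal, and a nonzero member of least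
  degree generates it; \<open>m\<close> shows that the ideal is not zero.\<close>

lemma poly_act_annihilator:
  fixes A :: "'a :: field mat"
  assumes A: "A \<in> carrier_mat n n" and v: "v \<in> carrier_vec n"
    and m: "m \<noteq> 0" "poly_act A m v = 0\<^sub>v n"
  obtains a where "monic a" "\<And>p. poly_act A p v = 0\<^sub>v n \<longleftrightarrow> a dvd p"
proof -
  obtain a0 where a0: "a0 \<noteq> 0" "poly_act A a0 v = 0\<^sub>v n"
    and min: "\<And>p. p \<noteq> 0 \<and> poly_act A p v = 0\<^sub>v n \<Longrightarrow> degree a0 \<le> degree p"
    using ex_has_least_nat[of "\<lambda>p. p \<noteq> 0 \<and> poly_act A p v = 0\<^sub>v n" m degree] m by blast
  define a where "a = Polynomial.smult (1 / lead_coeff a0) a0"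
  have deg: "degree a = degree a0" and mon: "monic a" using a0(1) by (simp_all add: a_def)
  have a: "poly_act A a v = 0\<^sub>v n"
    unfolding a_def poly_act_smult[OF A v] a0(2) by (intro eq_vecI) auto
  have "a \<noteq> 0" using mon by auto
  have mult: "poly_act A (a * r) v = 0\<^sub>v n" for r
    unfolding mult.commute[of a] poly_act_mult[OF A v] a by (rule poly_act_zero_vec[OF A])
  have "poly_act A p v = 0\<^sub>v n \<longleftrightarrow> a dvd p" for p
  proof
    assume p: "poly_act A p v = 0\<^sub>v n"
    have "poly_act A p v = poly_act A (a * (p div a)) v + poly_act A (p mod a) v"
      using poly_act_add[OF A v, of "a * (p div a)" "p mod a"] by simp
    then have "poly_act A (p mod a) v = 0\<^sub>v n"
      unfolding mult left_zero_vec[OF poly_act_carrier[OF A]] p by simp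
    then have "p mod a = 0 \<or> degree a \<le> degree (p mod a)" using min deg by auto
    then show "a dvd p" using degree_mod_less[OF \<open>a \<noteq> 0\<close>, of p] by auto
  next
    assume "a dvd p"
    then obtain r where "p = a * r" by (elim dvdE)
    then show "poly_act A p v = 0\<^sub>v n" using mult by simp
  qed
  then show ?thesis using that mon by blast
qed

text \<open>Passing from \<open>v\<close> to \<open>b(A) v\<close> divides the annihilator by
  \<open>b\<close>. This serves to isolate the \<open>p\<close>-part of one vector and the part
  prime to \<open>p\<close> of another.\<close>

lemma poly_act_mult_dvd_iff:
  fixes A :: "'a :: field mat"
  assumes A: "A \<in> carrier_mat n n" and v: "v \<in> carrier_vec n"
    and ann: "\<And>p. poly_act A p v = 0\<^sub>v n \<longleftrightarrow> b * c dvd p" and "b \<noteq> 0"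
  shows "poly_act A p (poly_act A b v) = 0\<^sub>v n \<longleftrightarrow> c dvd p"
  unfolding poly_act_mult[OF A v, symmetric] ann mult.commute[of p] using \<open>b \<noteq> 0\<close> by simp

text \<open>A vector whose annihilator has maximal degree is annihilated exactly by the polynomials
  killing the whole space: otherwise a prime power could be gained from another vector.\<close>
lemma cyclic_mat_imp_cyclic_vec:
  fixes A :: "'a :: field mat"
  assumes A: "A \<in> carrier_mat n n" and cyc: "cyclic_mat A"
  obtains v where "cyclic_vec A v"
proof -
  define m where "m = char_poly A"
  have dm: "dim_row A = n" using A by auto
  have "degree m = n" "monic m" using degree_monic_char_poly[OF A] by (auto simp: m_def)
  then have m0: "m \<noteq> 0" by auto
  have mA: "mat_poly_eval m A = 0\<^sub>m n n"
    and min: "\<And>r. r \<noteq> 0 \<Longrightarrow> mat_poly_eval r A = 0\<^sub>m n n \<Longrightarrow> n \<le> degree r"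
    using cyc \<open>degree m = n\<close> by (auto simp: cyclic_mat_def is_minimal_poly_def dm m_def)
  have mw: "poly_act A m w = 0\<^sub>v n" if "w \<in> carrier_vec n" for w
    unfolding poly_act_def mA using that by auto
  define gen where "gen = (\<lambda>v a. v \<in> carrier_vec n \<and> monic a \<and> (\<forall>p. poly_act A p v = 0\<^sub>v n \<longleftrightarrow> a dvd p))"
  have gen_ex: "\<exists>a. gen v a" if v: "v \<in> carrier_vec n" for v
  proof -
    obtain a where "monic a" "\<And>p. poly_act A p v = 0\<^sub>v n \<longleftrightarrow> a dvd p"
      using poly_act_annihilator[OF A v m0 mw[OF v]] by blast
    then show ?thesis using v unfolding gen_def by blast
  qed
  have genD: "poly_act A p v = 0\<^sub>v n \<longleftrightarrow> a dvd p" if "gen v a" for v a p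
    using that by (simp add: gen_def)
  have gen_le: "degree a < Suc n" if "gen v a" for v a
  proof -
    have "v \<in> carrier_vec n" using that by (simp add: gen_def)
    then have "a dvd m" using genD[OF that] mw by blast
    then show ?thesis using dvd_imp_degree_le[of a m] m0 \<open>degree m = n\<close> by simp
  qed
  obtain a1 where "gen (0\<^sub>v n) a1" using gen_ex[of "0\<^sub>v n"] by auto
  \<comment> \<open>Maximisation runs over pairs of a vector and its monic annihilator, starting
    from the zero vector. Degrees are bounded since each annihilator divides
    \<open>m\<close>.\<close>
  then have "\<exists>x. gen (fst x) (snd x) \<and> (\<forall>y. gen (fst y) (snd y) \<longrightarrow> degree (snd y) \<le> degree (snd x))"
    using gen_le
    by (intro ex_has_greatest_nat[of "\<lambda>x. gen (fst x) (snd x)" "(0\<^sub>v n, a1)" "\<lambda>x. degree (snd x)" "Suc n"]) simp_all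
  then obtain x where x: "gen (fst x) (snd x)" "\<And>y. gen (fst y) (snd y) \<Longrightarrow> degree (snd y) \<le> degree (snd x)"
    by blast
  obtain v a where va: "x = (v, a)" by (cases x)
  have v: "v \<in> carrier_vec n" and a: "monic a" and ann: "\<And>p. poly_act A p v = 0\<^sub>v n \<longleftrightarrow> a dvd p"
    using x(1) unfolding va gen_def by auto
  have max: "\<And>w b. gen w b \<Longrightarrow> degree b \<le> degree a" using x(2) va by fastforce
  have a0: "a \<noteq> 0" using a by auto
  have kill: "poly_act A a w = 0\<^sub>v n" if w: "w \<in> carrier_vec n" for w
  proof (rule ccontr)
    assume nz: "poly_act A a w \<noteq> 0\<^sub>v n"
    obtain b where "gen w b" using gen_ex[OF w] by blast
    then have b: "monic b" and annb: "\<And>p. poly_act A p w = 0\<^sub>v n \<longleftrightarrow> b dvd p"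
      unfolding gen_def by auto
    have nd: "\<not> b dvd a" using annb nz by blast
    have "b \<noteq> 0" using b by auto
    obtain p i a' b' where p1: "irreducible p" and pa: "a = p ^ i * a'"
      and p2: "\<not> p dvd a'" and pb': "b = p ^ Suc i * b'"
      using not_dvd_imp_prime_power[OF a0 \<open>b \<noteq> 0\<close> nd] .
    note p = p1 p2
    have pb: "b = b' * p ^ Suc i" unfolding pb' by (rule mult.commute)
    have p0: "p \<noteq> 0" using p by auto
    have b'0: "b' \<noteq> 0" using pb \<open>b \<noteq> 0\<close> by (intro notI) simp
    \<comment> \<open>\<open>v'\<close> has annihilator \<open>a'\<close> and \<open>w'\<close> has
      \<open>p ^ Suc i\<close>. These are coprime, so every polynomial killing
      \<open>v' + w'\<close> is a multiple of their product \<open>p * a\<close>, which contradicts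
      the maximality of \<open>degree a\<close>.\<close>
    define v' where "v' = poly_act A (p ^ i) v"
    define w' where "w' = poly_act A b' w"
    have v': "v' \<in> carrier_vec n" and w': "w' \<in> carrier_vec n"
      unfolding v'_def w'_def by (rule poly_act_carrier[OF A])+
    have annv': "poly_act A r v' = 0\<^sub>v n \<longleftrightarrow> a' dvd r" for r
      unfolding v'_def by (rule poly_act_mult_dvd_iff[OF A v ann[unfolded pa]]) (use p0 in simp)
    have annw': "poly_act A r w' = 0\<^sub>v n \<longleftrightarrow> p ^ Suc i dvd r" for r
      unfolding w'_def by (rule poly_act_mult_dvd_iff[OF A w annb[unfolded pb] b'0])
    have cop: "coprime (p ^ Suc i) a'"
      using coprime_irreducible_poly_iff[OF p(1)] p(2) coprime_poly_power_left by blast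
    have vw: "v' + w' \<in> carrier_vec n" using v' w' by simp
    obtain c where c: "gen (v' + w') c" using gen_ex[OF vw] by blast
    have "poly_act A c (v' + w') = 0\<^sub>v n" unfolding genD[OF c] by simp
    then have z: "poly_act A (s * c) v' + poly_act A (s * c) w' = 0\<^sub>v n" for s
      unfolding poly_act_add_vec[OF A v' w', symmetric] poly_act_mult[OF A vw]
      by (simp add: poly_act_zero_vec[OF A])
    have z1: "poly_act A (a' * c) v' = 0\<^sub>v n" unfolding annv' by simp
    have "poly_act A (a' * c) w' = 0\<^sub>v n"
      using z[of a'] unfolding z1 left_zero_vec[OF poly_act_carrier[OF A]] .
    then have "p ^ Suc i dvd c" unfolding annw' using cop coprime_poly_dvd_mult_cancel by blast
    have z2: "poly_act A (p ^ Suc i * c) w' = 0\<^sub>v n" unfolding annw' by (rule dvd_triv_left)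
    have "poly_act A (p ^ Suc i * c) v' = 0\<^sub>v n"
      using z[of "p ^ Suc i"] unfolding z2 right_zero_vec[OF poly_act_carrier[OF A]] .
    then have "a' dvd c" unfolding annv' using cop coprime_poly_dvd_mult_cancel
      by (metis coprime_commute)
    with \<open>p ^ Suc i dvd c\<close> have "p ^ Suc i * a' dvd c" by (intro coprime_poly_mult_dvd[OF cop])
    moreover have "c \<noteq> 0" using c unfolding gen_def by auto
    ultimately have le: "degree (p ^ Suc i * a') \<le> degree c" by (rule dvd_imp_degree_le)
    have eqp: "p ^ Suc i * a' = p * a" unfolding pa by (simp add: mult.assoc)
    have "degree p + degree a \<le> degree c" using le unfolding eqp degree_mult_eq[OF p0 a0] .
    then show False using max[OF c] irreducible_degree_pos[OF p(1)] by simp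
  qed
  \<comment> \<open>Here the cyclicity of \<open>A\<close> enters: a nonzero polynomial killing the
    whole space has degree at least \<open>n\<close>.\<close>
  have "mat_poly_eval a A = 0\<^sub>m n n"
    by (rule mat_eq_0I[OF mat_poly_eval_carrier[OF A] kill[unfolded poly_act_def]])
  then have "n \<le> degree a" using min a0 by blast
  then have "n \<le> degree p" if "p \<noteq> 0" "poly_act A p v = 0\<^sub>v n" for p
    using that(2) dvd_imp_degree_le[OF _ that(1), of a] unfolding ann by simp
  then have "cyclic_vec A v" using v by (simp add: cyclic_vec_iff[OF A])
  then show ?thesis using that by blast
qed

lemma poly_act_diff:
  fixes A :: "'a :: field mat"
  assumes A: "A \<in> carrier_mat n n" and v: "v \<in> carrier_vec n"
  shows "poly_act A p v = poly_act A q v \<longleftrightarrow> poly_act A (p - q) v = 0\<^sub>v n"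
proof -
  have eq: "poly_act A p v = poly_act A (p - q) v + poly_act A q v"
    using poly_act_add[OF A v, of "p - q" q] by simp
  show ?thesis
  proof
    assume "poly_act A p v = poly_act A q v"
    then have sum: "poly_act A (p - q) v + poly_act A q v = poly_act A q v" unfolding eq .
    have "poly_act A (p - q) v $ i = 0" if "i < n" for i
      using that carrier_vecD[OF poly_act_carrier[OF A, of q v]] arg_cong[OF sum, of "\<lambda>x. x $ i"]
      by (simp only: index_add_vec(1) add_cancel_left_left)
    then show "poly_act A (p - q) v = 0\<^sub>v n"
      using carrier_vecD[OF poly_act_carrier[OF A, of "p - q" v]] by (intro eq_vecI) simp_all
  next
    assume "poly_act A (p - q) v = 0\<^sub>v n"
    then show "poly_act A p v = poly_act A q v"
      unfolding eq using left_zero_vec[OF poly_act_carrier[OF A], of q v] by simp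
  qed
qed

text \<open>Every vector is \<open>h(A) v\<close> for exactly one residue \<open>h\<close> modulo
  \<open>f\<close>, and it is cyclic exactly when \<open>h\<close> is a unit modulo
  \<open>f\<close>.\<close>

lemma card_cyclic_vecs:
  fixes A :: "'a :: {finite,field} mat"
  assumes A: "A \<in> carrier_mat n n" and cyc: "cyclic_vec A v"
  shows "card {w. cyclic_vec A w} = poly_totient (char_poly A)"
proof -
  define f where "f = char_poly A"
  have f: "monic f" "degree f = n" "poly_act A f v = 0\<^sub>v n"
    using cyclic_vec_char_poly[OF A cyc] by (auto simp: f_def)
  then have f0: "f \<noteq> 0" by auto
  have v: "v \<in> carrier_vec n" using cyc cyclic_vec_iff[OF A] by blast
  note ann = poly_act_cyclic_eq_0_iff[OF A cyc f]
  have "bij_betw (\<lambda>h. poly_act A h v) (coprime_residues f) {w. cyclic_vec A w}"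
  proof (rule bij_betw_imageI)
    show "inj_on (\<lambda>h. poly_act A h v) (coprime_residues f)"
    proof (rule inj_onI)
      fix g h assume gh: "g \<in> coprime_residues f" "h \<in> coprime_residues f"
        and "poly_act A g v = poly_act A h v"
      then have "g mod f = h mod f" unfolding poly_act_diff[OF A v] ann mod_poly_eq_iff by blast
      then show "g = h" using gh by (simp add: coprime_residues_def residue_polys_def)
    qed
    show "(\<lambda>h. poly_act A h v) ` coprime_residues f = {w. cyclic_vec A w}"
    proof (intro equalityI subsetI)
      fix w assume "w \<in> (\<lambda>h. poly_act A h v) ` coprime_residues f"
      then obtain h where w: "w = poly_act A h v" and h: "coprime f h"
        by (auto simp: coprime_residues_def)
      have "n \<le> degree p" if "p \<noteq> 0" "poly_act A p w = 0\<^sub>v n" for p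
      proof -
        have "f dvd h * p"
          using that(2) unfolding w poly_act_mult[OF A v, symmetric] ann mult.commute[of p] .
        then have "f dvd p" using h coprime_poly_dvd_mult_cancel by blast
        then show ?thesis using that(1) dvd_imp_degree_le f(2) by blast
      qed
      then show "w \<in> {w. cyclic_vec A w}"
        using poly_act_carrier[OF A] unfolding cyclic_vec_iff[OF A] w by blast
    next
      fix w assume "w \<in> {w. cyclic_vec A w}"
      then have w: "w \<in> carrier_vec n" and cw: "\<And>p. p \<noteq> 0 \<Longrightarrow> poly_act A p w = 0\<^sub>v n \<Longrightarrow> n \<le> degree p"
        unfolding cyclic_vec_iff[OF A] by auto
      obtain h where h: "\<And>k. k \<ge> n \<Longrightarrow> coeff h k = 0" "poly_act A h v = w"
        using cyclic_vec_generates[OF A cyc w] by blast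
      \<comment> \<open>If \<open>c\<close> divides both, the cofactor \<open>f / c\<close> already
        kills \<open>w\<close>; cyclicity of \<open>w\<close> forces \<open>c\<close> to be
        constant.\<close>
      have "coprime f h"
      proof (rule coprimeI)
        fix c assume "c dvd f" "c dvd h"
        then obtain e k where e: "f = c * e" and k: "h = c * k" by (elim dvdE)
        have "poly_act A e w = 0\<^sub>v n"
          unfolding h(2)[symmetric] poly_act_mult[OF A v, symmetric] ann unfolding e k by simp
        moreover have "e \<noteq> 0" "c \<noteq> 0" using e f0 by auto
        ultimately have "degree f \<le> degree e" using cw f(2) by blast
        then have "degree c = 0" using e \<open>e \<noteq> 0\<close> \<open>c \<noteq> 0\<close> by (simp add: degree_mult_eq)
        then show "is_unit c" using \<open>c \<noteq> 0\<close> by (simp add: is_unit_iff_degree)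
      qed
      moreover have "h \<in> residue_polys f" using residue_polys_coeff_iff[OF f0] h(1) f(2) by blast
      ultimately show "w \<in> (\<lambda>h. poly_act A h v) ` coprime_residues f"
        using h(2) by (auto simp: coprime_residues_def)
    qed
  qed
  then show ?thesis unfolding poly_totient_def f_def[symmetric] by (simp add: bij_betw_same_card)
qed

section \<open>Counting cyclic matrices with given characteristic polynomial\<close>

lemma mult_mat_unit_vec:
  fixes M :: "'a :: field mat"
  assumes "M \<in> carrier_mat m n" "j < n"
  shows "M *\<^sub>v unit_vec n j = col M j"
  using assms by (intro eq_vecI) simp_all

lemma det_nonzero_cancel_right:
  fixes P :: "'a :: field mat"
  assumes P: "P \<in> carrier_mat n n" "det P \<noteq> 0"
    and A: "A \<in> carrier_mat n n" and B: "B \<in> carrier_mat n n" and eq: "A * P = B * P"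
  shows "A = B"
proof -
  obtain Q where Q: "Q \<in> carrier_mat n n" "P * Q = 1\<^sub>m n"
    using det_nonzero_inverse[OF P] by blast
  have *: "M = M * P * Q" if "M \<in> carrier_mat n n" for M
    unfolding assoc_mult_mat[OF that P(1) Q(1)] Q(2) right_mult_one_mat[OF that] ..
  have "A = A * P * Q" by (rule *[OF A])
  also have "\<dots> = B * P * Q" by (simp only: eq)
  also have "\<dots> = B" by (rule *[OF B, symmetric])
  finally show ?thesis .
qed

lemma GL_set_iff: "P \<in> GL_set n \<longleftrightarrow> P \<in> carrier_mat n n \<and> det P \<noteq> 0"
  by (simp add: GL_set_def)

lemma GL_set_mult: "P \<in> GL_set n \<Longrightarrow> Q \<in> GL_set n \<Longrightarrow> P * Q \<in> GL_set n"
  using det_mult[of P n Q] by (auto simp: GL_set_iff)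

lemma GL_set_inverse:
  assumes "P \<in> GL_set n"
  obtains Q where "Q \<in> GL_set n" "P * Q = 1\<^sub>m n" "Q * P = 1\<^sub>m n"
proof -
  have P: "P \<in> carrier_mat n n" "det P \<noteq> 0" using assms by (simp_all add: GL_set_iff)
  obtain Q where Q: "Q \<in> carrier_mat n n" "P * Q = 1\<^sub>m n" "Q * P = 1\<^sub>m n"
    using det_nonzero_inverse[OF P] .
  have "det P * det Q = 1" using det_mult[OF P(1) Q(1)] Q(2) by simp
  then have "Q \<in> GL_set n" using Q(1) by (auto simp: GL_set_iff)
  then show ?thesis using that Q by blast
qed

text \<open>Take \<open>A = P C P^-1\<close> and for \<open>v\<close> the first column of
  \<open>P\<close>. As \<open>C\<close> shifts the unit vectors, \<open>A\<close> shifts the columns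
  of \<open>P\<close>, so \<open>P\<close> is the Krylov matrix of \<open>v\<close>.\<close>

lemma krylov_mat_surj:
  fixes P :: "'a :: field mat"
  assumes P: "P \<in> GL_set n" and f: "monic f" "degree f = n"
  obtains A v where "A \<in> carrier_mat n n" "A * P = P * companion_mat n f" "krylov_mat A v = P"
    "cyclic_vec A v" "char_poly A = f"
proof -
  define C where "C = companion_mat n f"
  have C: "C \<in> carrier_mat n n" by (simp add: C_def)
  have P1: "P \<in> carrier_mat n n" "det P \<noteq> 0" using P by (simp_all add: GL_set_iff)
  obtain Q where Q: "Q \<in> carrier_mat n n" "P * Q = 1\<^sub>m n" "Q * P = 1\<^sub>m n"
    using det_nonzero_inverse[OF P1] .
  define A where "A = P * C * Q"
  define v where "v = vec n (\<lambda>i. P $$ (i, 0))"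
  have PC: "P * C \<in> carrier_mat n n" using P1 C by simp
  have A: "A \<in> carrier_mat n n" unfolding A_def using PC Q by simp
  have AP: "A * P = P * C"
    unfolding A_def assoc_mult_mat[OF PC Q(1) P1(1)] Q(3) right_mult_one_mat[OF PC] ..
  have v: "v \<in> carrier_vec n" by (simp add: v_def)
  have pw: "A ^\<^sub>m k \<in> carrier_mat n n" for k using A by simp
  have cols: "A ^\<^sub>m j *\<^sub>v v = col P j" if "j < n" for j
    using that
  proof (induction j)
    case 0
    have "v = col P 0" using P1 0 by (intro eq_vecI) (simp_all add: v_def)
    then show ?case using v carrier_matD(1)[OF A] by simp
  next
    case (Suc j)
    have "A ^\<^sub>m Suc j *\<^sub>v v = A *\<^sub>v col P j"
      unfolding pow_mat_Suc_left[OF A] assoc_mult_mat_vec[OF A pw v] using Suc by simp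
    also have "\<dots> = col (A * P) j" using col_mult2[OF A P1(1), of j] Suc by simp
    also have "\<dots> = P *\<^sub>v col C j" unfolding AP using col_mult2[OF P1(1) C, of j] Suc by simp
    also have "col C j = unit_vec n (Suc j)"
      using Suc by (intro eq_vecI) (auto simp: C_def companion_mat_def unit_vec_def)
    also have "P *\<^sub>v unit_vec n (Suc j) = col P (Suc j)" using mult_mat_unit_vec[OF P1(1)] Suc by simp
    finally show ?case .
  qed
  have K: "krylov_mat A v = P"
  proof (rule eq_matI)
    fix i j assume "i < dim_row P" "j < dim_col P"
    then have ij: "i < n" "j < n" using P1 by auto
    then have "krylov_mat A v $$ (i, j) = (A ^\<^sub>m j *\<^sub>v v) $ i"
      unfolding krylov_mat_def carrier_matD(1)[OF A] by simp
    then show "krylov_mat A v $$ (i, j) = P $$ (i, j)" using ij P1 by (simp add: cols[OF ij(2)])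
  qed (use P1 krylov_mat_carrier[OF A, of v] in auto)
  have cyc: "cyclic_vec A v" using v P1(2) unfolding cyclic_vec_iff_det_krylov_mat[OF A] K by blast
  have "similar_mat_wit A C P Q"
    by (rule similar_mat_witI[OF Q(2,3) A_def A C P1(1) Q(1)])
  then have "similar_mat A C" unfolding similar_mat_def by blast
  then have "char_poly A = char_poly C" by (rule char_poly_similar)
  then have "char_poly A = f" using char_poly_companion_mat[OF f] by (simp add: C_def)
  then show ?thesis using that[OF A AP[unfolded C_def] K cyc] by blast
qed

text \<open>\<open>P\<close> determines \<open>A\<close> as \<open>P C P^-1\<close> and
  \<open>v\<close> as its first column. The arbitrary condition \<open>R\<close> on \<open>A\<close>
  lets one bijection serve both GL(n,q) and the matrices fixing \<open>e_0\<close>.\<close>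

lemma krylov_mat_bij:
  fixes f :: "'a :: field poly"
  assumes f: "monic f" "degree f = n"
  shows "bij_betw (\<lambda>(A, v). krylov_mat A v)
    (SIGMA A:{A \<in> carrier_mat n n. R A \<and> cyclic_mat A \<and> char_poly A = f}. {v. cyclic_vec A v})
    {P \<in> GL_set n. \<exists>A\<in>carrier_mat n n. A * P = P * companion_mat n f \<and> R A}"
    (is "bij_betw ?k ?X ?Y")
proof (rule bij_betw_imageI)
  have X: "krylov_mat A v \<in> GL_set n" "A * krylov_mat A v = krylov_mat A v * companion_mat n f" "R A"
    "A \<in> carrier_mat n n" "v \<in> carrier_vec n" if "(A, v) \<in> ?X" for A v
  proof -
    show A: "A \<in> carrier_mat n n" and "R A" using that by auto
    have cyc: "cyclic_vec A v" and chf: "char_poly A = f" using that by auto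
    show "v \<in> carrier_vec n" using cyc unfolding cyclic_vec_iff[OF A] by blast
    show "krylov_mat A v \<in> GL_set n"
      using cyc krylov_mat_carrier[OF A] unfolding cyclic_vec_iff_det_krylov_mat[OF A] GL_set_iff by blast
    show "A * krylov_mat A v = krylov_mat A v * companion_mat n f"
      using mult_krylov_mat[OF A cyc cyclic_vec_char_poly[OF A cyc]] by (simp only: chf)
  qed
  show "inj_on ?k ?X"
  proof (rule inj_onI, clarify)
    fix A v B w
    assume Av: "A \<in> carrier_mat n n" "R A" "cyclic_mat A" "f = char_poly A" "cyclic_vec A v"
      and Bw: "B \<in> carrier_mat n n" "R B" "cyclic_mat B" "char_poly B = char_poly A" "cyclic_vec B w"
      and k: "krylov_mat A v = krylov_mat B w"
    have 1: "(A, v) \<in> ?X" and 2: "(B, w) \<in> ?X" using Av Bw by auto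
    have "A * krylov_mat A v = B * krylov_mat A v"
      unfolding X(2)[OF 1] using X(2)[OF 2] unfolding k[symmetric] by (rule sym)
    then have "A = B"
      using X(1)[OF 1] Av(1) Bw(1) det_nonzero_cancel_right unfolding GL_set_iff by blast
    moreover have "v = w"
    proof (rule eq_vecI)
      show "dim_vec v = dim_vec w" using X(5)[OF 1] X(5)[OF 2] by simp
      fix i assume "i < dim_vec w"
      then have i: "i < n" using X(5)[OF 2] by simp
      have "krylov_mat M u $$ (i, 0) = u $ i" if "M \<in> carrier_mat n n" "u \<in> carrier_vec n" for M u
        using i that unfolding krylov_mat_def carrier_matD(1)[OF that(1)] by simp
      then show "v $ i = w $ i" using k X(4,5)[OF 1] X(4,5)[OF 2] by metis
    qed
    ultimately show "A = B \<and> v = w" by blast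
  qed
  show "?k ` ?X = ?Y"
  proof (intro equalityI subsetI)
    fix P assume "P \<in> ?k ` ?X"
    then obtain A v where Av: "(A, v) \<in> ?X" and P: "P = krylov_mat A v" by auto
    show "P \<in> ?Y" unfolding P using X[OF Av] by blast
  next
    fix P assume "P \<in> ?Y"
    then obtain B where P: "P \<in> GL_set n" and B: "B \<in> carrier_mat n n" "B * P = P * companion_mat n f" "R B"
      by blast
    obtain A v where A: "A \<in> carrier_mat n n" "A * P = P * companion_mat n f" and K: "krylov_mat A v = P"
      and cyc: "cyclic_vec A v" and "char_poly A = f"
      using krylov_mat_surj[OF P f] .
    have "P \<in> carrier_mat n n" "det P \<noteq> 0" using P by (simp_all add: GL_set_iff)
    then have "A = B"
      by (rule det_nonzero_cancel_right[OF _ _ A(1) B(1)]) (simp only: A(2) B(2))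
    then have "(A, v) \<in> ?X"
      using A(1) B(3) cyc cyclic_vec_imp_cyclic_mat[OF A(1) cyc] \<open>char_poly A = f\<close> by blast
    then show "P \<in> ?k ` ?X" using K by force
  qed
qed

lemma finite_carrier_mat: "finite (carrier_mat m n :: 'a :: finite mat set)"
proof -
  have "carrier_mat m n \<subseteq> (\<lambda>f. mat m n f) ` (({..<m} \<times> {..<n}) \<rightarrow>\<^sub>E (UNIV :: 'a set))"
  proof
    fix M :: "'a mat" assume M: "M \<in> carrier_mat m n"
    show "M \<in> (\<lambda>f. mat m n f) ` (({..<m} \<times> {..<n}) \<rightarrow>\<^sub>E UNIV)"
    proof (rule image_eqI)
      show "M = mat m n (restrict (($$) M) ({..<m} \<times> {..<n}))"
        using M by (intro eq_matI) auto
    qed simp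
  qed
  then show ?thesis by (rule finite_subset) (intro finite_imageI finite_PiE, auto)
qed

lemma finite_carrier_vec: "finite (carrier_vec n :: 'a :: finite vec set)"
proof -
  have "carrier_vec n \<subseteq> (\<lambda>M. col M 0) ` (carrier_mat n 1 :: 'a mat set)"
  proof
    fix v :: "'a vec" assume v: "v \<in> carrier_vec n"
    have "v = col (mat n 1 (\<lambda>(i, j). v $ i)) 0" using v by (intro eq_vecI) auto
    then show "v \<in> (\<lambda>M. col M 0) ` carrier_mat n 1" by (rule image_eqI) simp
  qed
  then show ?thesis by (rule finite_subset) (intro finite_imageI finite_carrier_mat)
qed

text \<open>Double counting of pairs: the number of cyclic vectors of \<open>A\<close> depends only
  on \<open>f\<close>, so the pairs form a product count.\<close>

lemma card_cyclic_mats_char_poly: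
  fixes f :: "'a :: {finite,field} poly"
  assumes f: "monic f" "degree f = n"
  shows "card {A \<in> carrier_mat n n. R A \<and> cyclic_mat A \<and> char_poly A = f} * poly_totient f =
    card {P \<in> GL_set n. \<exists>A\<in>carrier_mat n n. A * P = P * companion_mat n f \<and> R A}"
proof -
  let ?X = "{A \<in> carrier_mat n n. R A \<and> cyclic_mat A \<and> char_poly A = f}"
  have "card {v. cyclic_vec A v} = poly_totient f" "finite {v. cyclic_vec A v}" if "A \<in> ?X" for A
  proof -
    have A: "A \<in> carrier_mat n n" "cyclic_mat A" "char_poly A = f" using that by auto
    obtain v where "cyclic_vec A v" using cyclic_mat_imp_cyclic_vec[OF A(1,2)] .
    then show "card {v. cyclic_vec A v} = poly_totient f"
      using card_cyclic_vecs[OF A(1)] A(3) by blast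
    show "finite {v. cyclic_vec A v}"
      by (rule finite_subset[OF _ finite_carrier_vec[of n]]) (use cyclic_vec_iff[OF A(1)] in blast)
  qed
  moreover have "finite ?X" by (rule finite_subset[OF _ finite_carrier_mat[of n n]]) blast
  ultimately have "card (SIGMA A:?X. {v. cyclic_vec A v}) = card ?X * poly_totient f"
    by (subst card_SigmaI) simp_all
  then show ?thesis using bij_betw_same_card[OF krylov_mat_bij[OF f, of R]] by simp
qed

lemma card_cyclic_GL_char_poly:
  fixes f :: "'a :: {finite,field} poly"
  assumes f: "monic f" "degree f = n"
  shows "card {A \<in> carrier_mat n n. cyclic_mat A \<and> char_poly A = f} * poly_totient f =
    card (GL_set n :: 'a mat set)"
proof -
  have "{P \<in> GL_set n. \<exists>A\<in>carrier_mat n n. A * P = P * companion_mat n f \<and> True} = GL_set n"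
    using krylov_mat_surj[OF _ f] by blast
  then show ?thesis using card_cyclic_mats_char_poly[OF f, of "\<lambda>_. True"] by simp
qed

section \<open>A(n,q) as the stabiliser of \<open>e_0\<close>, and its cosets\<close>

lemma A_set_iff:
  "x \<in> A_set m \<longleftrightarrow> x \<in> GL_set (Suc m) \<and> x *\<^sub>v unit_vec (Suc m) 0 = unit_vec (Suc m) 0"
proof (cases "x \<in> GL_set (Suc m)")
  case True
  then have x: "x \<in> carrier_mat (Suc m) (Suc m)" by (simp add: GL_set_iff)
  have "col x 0 = unit_vec (Suc m) 0 \<longleftrightarrow> (\<forall>i<Suc m. x $$ (i, 0) = (if i = 0 then 1 else 0))"
    using x by (auto simp: vec_eq_iff unit_vec_def)
  also have "\<dots> \<longleftrightarrow> x $$ (0,0) = 1 \<and> (\<forall>j\<in>{1..m}. x $$ (j,0) = 0)"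
    by (auto simp: less_Suc_eq_le)
  finally show ?thesis using True mult_mat_unit_vec[OF x, of 0] by (simp add: A_set_def)
qed (simp add: A_set_def)

lemma GL_set_transitive:
  fixes y :: "'a :: field vec"
  assumes y: "y \<in> carrier_vec (Suc m)" "y \<noteq> 0\<^sub>v (Suc m)"
  obtains Q where "Q \<in> GL_set (Suc m)" "Q *\<^sub>v unit_vec (Suc m) 0 = y"
proof -
  obtain k where k: "k < Suc m" "y $ k \<noteq> 0"
  proof (rule ccontr)
    assume "\<not> thesis"
    then have "\<forall>k<Suc m. y $ k = 0" using that by blast
    then have "y = 0\<^sub>v (Suc m)" using y(1) by (intro eq_vecI) auto
    then show False using y(2) by blast
  qed
  \<comment> \<open>The columns are \<open>y\<close> followed by the unit vectors other than
    \<open>e_k\<close>, since \<open>insert_index k\<close> skips \<open>k\<close>. Row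
    \<open>k\<close> vanishes except for \<open>y $ k\<close>, and deleting it with the first column
    leaves the identity.\<close>
  define Q where "Q = mat (Suc m) (Suc m)
    (\<lambda>(i, j). if j = 0 then y $ i else if i = insert_index k (j - 1) then 1 else 0)"
  have Q: "Q \<in> carrier_mat (Suc m) (Suc m)" by (simp add: Q_def)
  have del: "mat_delete Q k 0 = 1\<^sub>m m"
    by (rule eq_matI) (auto simp: mat_delete_def Q_def insert_index_def split: if_splits)
  have "det Q = (\<Sum>j<Suc m. Q $$ (k, j) * cofactor Q k j)"
    by (rule laplace_expansion_row[OF Q k(1)])
  also have "\<dots> = (\<Sum>j<Suc m. if j = 0 then y $ k * cofactor Q k 0 else 0)"
    using k(1) by (intro sum.cong refl) (auto simp: Q_def insert_index_def)
  also have "\<dots> = y $ k * (- 1) ^ k" by (simp add: cofactor_def del)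
  finally have "det Q \<noteq> 0" using k(2) by simp
  moreover have "Q *\<^sub>v unit_vec (Suc m) 0 = y"
    unfolding mult_mat_unit_vec[OF Q zero_less_Suc] using y(1) by (intro eq_vecI) (auto simp: Q_def)
  ultimately show ?thesis using that Q by (simp add: GL_set_iff)
qed

text \<open>These matrices form a coset of the stabiliser of \<open>e_0\<close>: right
  multiplication by a \<open>Q\<close> that takes \<open>e_0\<close> to \<open>y\<close> carries
  them onto it.\<close>

lemma card_GL_set_maps_to_unit_vec:
  fixes y :: "'a :: field vec"
  assumes y: "y \<in> carrier_vec (Suc m)" "y \<noteq> 0\<^sub>v (Suc m)"
  shows "card {P \<in> GL_set (Suc m). P *\<^sub>v y = unit_vec (Suc m) 0} = card (A_set m :: 'a mat set)"
proof -
  let ?e = "unit_vec (Suc m) 0 :: 'a vec"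
  obtain Q where Q: "Q \<in> GL_set (Suc m)" "Q *\<^sub>v ?e = y" using GL_set_transitive[OF y] .
  obtain Q' where Q': "Q' \<in> GL_set (Suc m)" "Q * Q' = 1\<^sub>m (Suc m)" "Q' * Q = 1\<^sub>m (Suc m)"
    using GL_set_inverse[OF Q(1)] .
  have Qc: "Q \<in> carrier_mat (Suc m) (Suc m)" "Q' \<in> carrier_mat (Suc m) (Suc m)"
    using Q Q' by (simp_all add: GL_set_iff)
  have e: "?e \<in> carrier_vec (Suc m)" by simp
  have Q'y: "Q' *\<^sub>v y = ?e"
    unfolding Q(2)[symmetric] assoc_mult_mat_vec[OF Qc(2,1) e, symmetric] Q'(3) by simp
  have "bij_betw (\<lambda>P. P * Q) {P \<in> GL_set (Suc m). P *\<^sub>v y = ?e} (A_set m)"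
  proof (rule bij_betwI[where g = "\<lambda>P. P * Q'"])
    show "(\<lambda>P. P * Q) \<in> {P \<in> GL_set (Suc m). P *\<^sub>v y = ?e} \<rightarrow> A_set m"
    proof (intro funcsetI)
      fix P assume "P \<in> {P \<in> GL_set (Suc m). P *\<^sub>v y = ?e}"
      then have P: "P \<in> GL_set (Suc m)" "P *\<^sub>v y = ?e" by auto
      then have Pc: "P \<in> carrier_mat (Suc m) (Suc m)" by (simp add: GL_set_iff)
      show "P * Q \<in> A_set m"
        unfolding A_set_iff assoc_mult_mat_vec[OF Pc Qc(1) e] Q(2) P(2) using GL_set_mult[OF P(1) Q(1)] by blast
    qed
    show "(\<lambda>P. P * Q') \<in> A_set m \<rightarrow> {P \<in> GL_set (Suc m). P *\<^sub>v y = ?e}"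
    proof (intro funcsetI)
      fix P :: "'a mat" assume "P \<in> A_set m"
      then have P: "P \<in> GL_set (Suc m)" "P *\<^sub>v ?e = ?e" unfolding A_set_iff by auto
      then have Pc: "P \<in> carrier_mat (Suc m) (Suc m)" by (simp add: GL_set_iff)
      have "P * Q' *\<^sub>v y = ?e" unfolding assoc_mult_mat_vec[OF Pc Qc(2) y(1)] Q'y P(2) ..
      then show "P * Q' \<in> {P \<in> GL_set (Suc m). P *\<^sub>v y = ?e}" using GL_set_mult[OF P(1) Q'(1)] by blast
    qed
    show "P * Q * Q' = P" if "P \<in> {P \<in> GL_set (Suc m). P *\<^sub>v y = ?e}" for P
    proof -
      have Pc: "P \<in> carrier_mat (Suc m) (Suc m)" using that by (simp add: GL_set_iff)
      show ?thesis unfolding assoc_mult_mat[OF Pc Qc] Q'(2) right_mult_one_mat[OF Pc] ..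
    qed
    show "P * Q' * Q = P" if "P \<in> A_set m" for P
    proof -
      have Pc: "P \<in> carrier_mat (Suc m) (Suc m)" using that by (simp add: GL_set_iff A_set_iff)
      show ?thesis unfolding assoc_mult_mat[OF Pc Qc(2,1)] Q'(3) right_mult_one_mat[OF Pc] ..
    qed
  qed
  then show ?thesis by (rule bij_betw_same_card)
qed

lemma linear_mult_poly:
  fixes g :: "'a :: field poly"
  assumes "g \<noteq> 0"
  shows "degree ([:a, 1:] * g) = Suc (degree g)" "lead_coeff ([:a, 1:] * g) = lead_coeff g"
proof -
  have "degree ([:a, 1:] * g) = degree [:a, 1:] + degree g" by (rule degree_mult_eq) (use assms in auto)
  then show "degree ([:a, 1:] * g) = Suc (degree g)" by simp
  have "lead_coeff ([:a, 1:] * g) = lead_coeff [:a, 1:] * lead_coeff g" by (rule lead_coeff_mult)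
  then show "lead_coeff ([:a, 1:] * g) = lead_coeff g" by simp
qed

text \<open>In F[t]/(f) with f = (t - 1) g, a residue \<open>h\<close> is fixed by t iff f divides
  (t - 1) h, i.e. iff g divides \<open>h\<close>. As \<open>h\<close> has degree at most
  \<open>m = degree g\<close>, it is a scalar multiple of g; so \<open>y\<close> is
  \<open>g(C) v\<close>.\<close>

lemma companion_mat_fixed_vecs:
  fixes g :: "'a :: field poly"
  assumes g: "monic g" "degree g = m"
  obtains y where "y \<in> carrier_vec (Suc m)" "y \<noteq> 0\<^sub>v (Suc m)"
    "\<And>z. z \<in> carrier_vec (Suc m) \<Longrightarrow>
      companion_mat (Suc m) ([:-1, 1:] * g) *\<^sub>v z = z \<longleftrightarrow> (\<exists>c. z = c \<cdot>\<^sub>v y)"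
proof -
  define n where "n = Suc m"
  define f where "f = [:-1, 1:] * g"
  define C where "C = companion_mat n f"
  have g0: "g \<noteq> 0" using g by auto
  have f: "monic f" "degree f = n"
    using g linear_mult_poly[OF g0, of "-1"] unfolding f_def n_def by (simp_all only:)
  have C: "C \<in> carrier_mat n n" by (simp add: C_def)
  \<comment> \<open>With \<open>P\<close> the identity the matrix supplied by
    \<open>krylov_mat_surj\<close> is \<open>C\<close> itself, which gives a cyclic vector of
    \<open>C\<close>.\<close>
  have one: "1\<^sub>m n \<in> GL_set n" by (simp add: GL_set_iff)
  obtain A v where A: "A \<in> carrier_mat n n" "A * 1\<^sub>m n = 1\<^sub>m n * C" and "cyclic_vec A v" "char_poly A = f"
    using krylov_mat_surj[OF one f] unfolding C_def by blast
  have "A = C" using A C by simp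
  then have cyc: "cyclic_vec C v" and cp: "char_poly C = f"
    using \<open>cyclic_vec A v\<close> \<open>char_poly A = f\<close> by auto
  have v: "v \<in> carrier_vec n" using cyc unfolding cyclic_vec_iff[OF C] by blast
  note ann = poly_act_cyclic_eq_0_iff[OF C cyc f cyclic_vec_char_poly(3)[OF C cyc, unfolded cp]]
  define y where "y = poly_act C g v"
  have y: "y \<in> carrier_vec n" unfolding y_def by (rule poly_act_carrier[OF C])
  have y0: "y \<noteq> 0\<^sub>v n"
  proof
    assume "y = 0\<^sub>v n"
    then have "f dvd g" unfolding y_def ann .
    then have "degree f \<le> degree g" using g0 by (rule dvd_imp_degree_le)
    then show False using f(2) g(2) by (simp add: n_def)
  qed
  have fixed: "C *\<^sub>v z = z \<longleftrightarrow> poly_act C [:-1, 1:] z = 0\<^sub>v n" if z: "z \<in> carrier_vec n" for z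
  proof -
    have Cz: "C *\<^sub>v z \<in> carrier_vec n" using C z by simp
    have eq: "poly_act C [:-1, 1:] z = (-1) \<cdot>\<^sub>v z + C *\<^sub>v z"
      using poly_act_pCons[OF C z, of "-1" "[:1:]"] poly_act_1[OF C z] by (simp add: one_pCons[symmetric])
    have d: "dim_vec z = n" "dim_vec (C *\<^sub>v z) = n" using carrier_vecD[OF z] carrier_vecD[OF Cz] by auto
    show ?thesis
      unfolding eq vec_eq_iff index_zero_vec index_add_vec(2) d using d by (auto simp del: index_mult_mat_vec)
  qed
  have "C *\<^sub>v z = z \<longleftrightarrow> (\<exists>c. z = c \<cdot>\<^sub>v y)" if z: "z \<in> carrier_vec n" for z
  proof
    assume "C *\<^sub>v z = z"
    obtain h where h: "\<And>k. k \<ge> n \<Longrightarrow> coeff h k = 0" "poly_act C h v = z"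
      using cyclic_vec_generates[OF C cyc z] by blast
    have "poly_act C [:-1, 1:] (poly_act C h v) = 0\<^sub>v n" using \<open>C *\<^sub>v z = z\<close> fixed[OF z] h(2) by simp
    then have "f dvd [:-1, 1:] * h" unfolding poly_act_mult[OF C v, symmetric] ann .
    then have "g dvd h" unfolding f_def by (simp only: dvd_mult_cancel_left) simp
    then obtain k where k: "h = k * g" by (metis dvdE mult.commute)
    have "degree k = 0"
    proof (cases "k = 0")
      case False
      then have "h \<noteq> 0" "degree h = degree k + m" using k g0 g by (auto simp: degree_mult_eq)
      moreover have "degree h < n" using h(1)[of "degree h"] \<open>h \<noteq> 0\<close> by (metis leading_coeff_0_iff not_le)
      ultimately show ?thesis by (simp add: n_def)
    qed simp
    then obtain c where "k = [:c:]" by (elim degree_eq_zeroE)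
    then have "z = c \<cdot>\<^sub>v y"
      unfolding h(2)[symmetric] k poly_act_mult[OF C v] y_def using poly_act_const[OF C poly_act_carrier[OF C]] by simp
    then show "\<exists>c. z = c \<cdot>\<^sub>v y" by blast
  next
    assume "\<exists>c. z = c \<cdot>\<^sub>v y"
    then obtain c where c: "z = c \<cdot>\<^sub>v y" by blast
    have "C *\<^sub>v y = y"
      unfolding fixed[OF y] unfolding y_def poly_act_mult[OF C v, symmetric] ann f_def by simp
    then show "C *\<^sub>v z = z" unfolding c mult_mat_vec[OF C y] by simp
  qed
  then show ?thesis using that[of y] y y0 unfolding C_def f_def n_def by blast
qed

text \<open>Conjugates \<open>A = P C P\<inverse>\<close> fixing \<open>e\<^sub>0\<close> correspond to \<open>P\<close> whose inverse maps
  \<open>e\<^sub>0\<close> into the one-dimensional space of fixed vectors of \<open>C\<close>.\<close>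
lemma card_cyclic_A_char_poly:
  fixes f :: "'a :: {finite,field} poly"
  assumes f: "monic f" "degree f = Suc m" "poly f 1 = 0"
  shows "card {A \<in> carrier_mat (Suc m) (Suc m). A *\<^sub>v unit_vec (Suc m) 0 = unit_vec (Suc m) 0 \<and>
      cyclic_mat A \<and> char_poly A = f} * poly_totient f = (CARD('a) - 1) * card (A_set m :: 'a mat set)"
proof -
  define n where "n = Suc m"
  define e :: "'a vec" where "e = unit_vec n 0"
  have e: "e \<in> carrier_vec n" "e \<noteq> 0\<^sub>v n" by (simp_all add: e_def n_def)
  define C where "C = companion_mat n f"
  have C: "C \<in> carrier_mat n n" by (simp add: C_def)
  obtain g where fg: "f = [:-1, 1:] * g" using f(3) by (auto simp: poly_eq_0_iff_dvd elim: dvdE)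
  have g0: "g \<noteq> 0" using fg f by auto
  have g: "monic g" "degree g = m"
    using f(1,2) linear_mult_poly[OF g0, of "-1"] unfolding fg by (simp_all only: nat.inject)
  obtain y where y: "y \<in> carrier_vec n" "y \<noteq> 0\<^sub>v n"
    and fixed: "\<And>z. z \<in> carrier_vec n \<Longrightarrow> C *\<^sub>v z = z \<longleftrightarrow> (\<exists>c. z = c \<cdot>\<^sub>v y)"
    using companion_mat_fixed_vecs[OF g] unfolding fg[symmetric] n_def[symmetric] C_def[symmetric] by blast
  obtain k where k: "k < n" "y $ k \<noteq> 0"
  proof (rule ccontr)
    assume "\<not> thesis"
    then have "\<forall>k<n. y $ k = 0" using that by blast
    then have "y = 0\<^sub>v n" using y(1) by (intro eq_vecI) auto
    then show False using y(2) by blast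
  qed
  have inj: "c = d" if "c \<cdot>\<^sub>v y = d \<cdot>\<^sub>v y" for c d
    using arg_cong[OF that, of "\<lambda>x. x $ k"] k y(1) by simp
  have cy: "c \<cdot>\<^sub>v y \<in> carrier_vec n" for c using y(1) by simp
  have cy0: "c \<cdot>\<^sub>v y \<noteq> 0\<^sub>v n" if "c \<noteq> 0" for c
  proof
    assume eq: "c \<cdot>\<^sub>v y = 0\<^sub>v n"
    show False using arg_cong[OF eq, of "\<lambda>x. x $ k"] k y(1) that by simp
  qed
  \<comment> \<open>\<open>W c\<close> collects the \<open>P\<close> whose inverse takes
    \<open>e\<close> to \<open>c\<close> times \<open>y\<close>. \<open>P\<close> determines
    \<open>c\<close>, so the classes are disjoint; there is one for each nonzero scalar, all of the
    same size.\<close>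
  define W where "W c = {P \<in> GL_set n. P *\<^sub>v (c \<cdot>\<^sub>v y) = e}" for c
  have "{P \<in> GL_set n. \<exists>A\<in>carrier_mat n n. A * P = P * C \<and> A *\<^sub>v e = e} = (\<Union>c\<in>UNIV - {0}. W c)"
  proof (intro equalityI subsetI)
    fix P assume "P \<in> {P \<in> GL_set n. \<exists>A\<in>carrier_mat n n. A * P = P * C \<and> A *\<^sub>v e = e}"
    then obtain A where P: "P \<in> GL_set n" and A: "A \<in> carrier_mat n n" "A * P = P * C" "A *\<^sub>v e = e" by blast
    have Pc: "P \<in> carrier_mat n n" "det P \<noteq> 0" using P by (simp_all add: GL_set_iff)
    obtain Q where Q: "Q \<in> carrier_mat n n" "P * Q = 1\<^sub>m n" using det_nonzero_inverse[OF Pc] by blast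
    define z where "z = Q *\<^sub>v e"
    have z: "z \<in> carrier_vec n" unfolding z_def using Q(1) e(1) by simp
    have Pz: "P *\<^sub>v z = e"
      unfolding z_def assoc_mult_mat_vec[OF Pc(1) Q(1) e(1), symmetric] Q(2) using e(1) by simp
    have Cz: "C *\<^sub>v z \<in> carrier_vec n" using C z by simp
    have "P *\<^sub>v (C *\<^sub>v z) = A *\<^sub>v (P *\<^sub>v z)"
      unfolding assoc_mult_mat_vec[OF Pc(1) C z, symmetric] A(2)[symmetric] assoc_mult_mat_vec[OF A(1) Pc(1) z] ..
    then have "P *\<^sub>v (C *\<^sub>v z) = P *\<^sub>v z" unfolding Pz A(3) .
    then have "C *\<^sub>v z = z" by (rule det_nonzero_cancel_vec[OF Pc Cz z])
    then obtain c where c: "z = c \<cdot>\<^sub>v y" using fixed[OF z] by blast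
    have "c \<noteq> 0"
    proof
      assume "c = 0"
      then have "z = 0\<^sub>v n" unfolding c using y(1) by (intro eq_vecI) auto
      then have "e = 0\<^sub>v n" using Pz mult_mat_zero_vec[OF Pc(1)] by simp
      then show False using e(2) by blast
    qed
    then show "P \<in> (\<Union>c\<in>UNIV - {0}. W c)" using P Pz unfolding W_def c by blast
  next
    fix P assume "P \<in> (\<Union>c\<in>UNIV - {0}. W c)"
    then obtain c where P: "P \<in> GL_set n" and Pc: "P *\<^sub>v (c \<cdot>\<^sub>v y) = e" unfolding W_def by blast
    have Pm: "P \<in> carrier_mat n n" using P by (simp add: GL_set_iff)
    obtain A where A: "A \<in> carrier_mat n n" "A * P = P * C"
      using krylov_mat_surj[OF P f(1) f(2)[folded n_def]] unfolding C_def by blast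
    have Cy: "C *\<^sub>v (c \<cdot>\<^sub>v y) = c \<cdot>\<^sub>v y" using fixed[OF cy] by blast
    have "A *\<^sub>v e = (A * P) *\<^sub>v (c \<cdot>\<^sub>v y)"
      unfolding assoc_mult_mat_vec[OF A(1) Pm cy] Pc ..
    also have "\<dots> = e" unfolding A(2) assoc_mult_mat_vec[OF Pm C cy] Cy Pc ..
    finally show "P \<in> {P \<in> GL_set n. \<exists>A\<in>carrier_mat n n. A * P = P * C \<and> A *\<^sub>v e = e}"
      using P A by blast
  qed
  moreover have "card (\<Union>c\<in>UNIV - {0}. W c) = (\<Sum>c\<in>UNIV - {0}. card (W c))"
  proof (rule card_UN_disjoint)
    show "\<forall>c\<in>UNIV - {0}. finite (W c)"
      unfolding W_def GL_set_def by (intro ballI finite_subset[OF _ finite_carrier_mat[of n n]]) blast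
    show "\<forall>c\<in>UNIV - {0}. \<forall>d\<in>UNIV - {0}. c \<noteq> d \<longrightarrow> W c \<inter> W d = {}"
    proof (intro ballI impI)
      fix c d :: 'a assume "c \<noteq> d"
      have False if "P \<in> W c" "P \<in> W d" for P
      proof -
        have P: "P \<in> carrier_mat n n" "det P \<noteq> 0" "P *\<^sub>v (c \<cdot>\<^sub>v y) = P *\<^sub>v (d \<cdot>\<^sub>v y)"
          using that by (simp_all add: W_def GL_set_iff)
        have "c \<cdot>\<^sub>v y = d \<cdot>\<^sub>v y" by (rule det_nonzero_cancel_vec[OF P(1,2) cy cy P(3)])
        then show False using inj \<open>c \<noteq> d\<close> by blast
      qed
      then show "W c \<inter> W d = {}" by blast
    qed
  qed simp
  moreover have "card (W c) = card (A_set m :: 'a mat set)" if "c \<in> UNIV - {0}" for c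
    unfolding W_def e_def n_def
    by (rule card_GL_set_maps_to_unit_vec) (use cy[of c] cy0[of c] that in \<open>simp_all add: n_def\<close>)
  ultimately have "card {P \<in> GL_set n. \<exists>A\<in>carrier_mat n n. A * P = P * C \<and> A *\<^sub>v e = e} =
      (CARD('a) - 1) * card (A_set m :: 'a mat set)"
    by (simp add: card_Diff_singleton)
  then show ?thesis
    using card_cyclic_mats_char_poly[OF f(1,2), of "\<lambda>A. A *\<^sub>v unit_vec (Suc m) 0 = unit_vec (Suc m) 0"]
    unfolding C_def e_def n_def by simp
qed

section \<open>The proportions as sums over characteristic polynomials\<close>

lemma det_eq_0_iff_char_poly:
  fixes A :: "'a :: field mat"
  assumes A: "A \<in> carrier_mat n n"
  shows "det A = 0 \<longleftrightarrow> poly (char_poly A) 0 = 0"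
proof -
  have "0 \<cdot>\<^sub>v v = 0\<^sub>v n" if "v \<in> carrier_vec n" for v :: "'a vec" using that by (intro eq_vecI) auto
  then have "(v \<in> carrier_vec n \<and> v \<noteq> 0\<^sub>v n \<and> A *\<^sub>v v = 0\<^sub>v n) \<longleftrightarrow>
      (v \<in> carrier_vec n \<and> v \<noteq> 0\<^sub>v n \<and> A *\<^sub>v v = 0 \<cdot>\<^sub>v v)" for v
    by (intro conj_cong refl) simp
  then show ?thesis
    unfolding eigenvalue_root_char_poly[OF A, symmetric] det_0_iff_vec_prod_zero_field[OF A]
      eigenvalue_def eigenvector_def carrier_matD(1)[OF A] by (simp only:)
qed

lemma cGL_eq_sum:
  fixes T :: "'a :: {finite,field} itself"
  shows "cGL T n = (\<Sum>f | monic f \<and> degree f = n \<and> poly f 0 \<noteq> 0. 1 / real (poly_totient (f :: 'a poly)))"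
proof -
  let ?F = "{f :: 'a poly. monic f \<and> degree f = n \<and> poly f 0 \<noteq> 0}"
  let ?X = "\<lambda>f. {A \<in> carrier_mat n n. cyclic_mat A \<and> char_poly A = (f :: 'a poly)}"
  have fin: "finite (GL_set n :: 'a mat set)"
    unfolding GL_set_def by (rule finite_subset[OF _ finite_carrier_mat[of n n]]) blast
  have "1\<^sub>m n \<in> (GL_set n :: 'a mat set)" by (simp add: GL_set_iff)
  then have pos: "card (GL_set n :: 'a mat set) > 0" using fin card_gt_0_iff by blast
  have deg: "monic (char_poly A)" "degree (char_poly A) = n" if "A \<in> carrier_mat n n" for A :: "'a mat"
    using degree_monic_char_poly[OF that] by simp_all
  have "{x \<in> (GL_set n :: 'a mat set). cyclic_mat x} = (\<Union>f\<in>?F. ?X f)"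
    using det_eq_0_iff_char_poly deg by (auto simp: GL_set_iff)
  moreover have "card (\<Union>f\<in>?F. ?X f) = (\<Sum>f\<in>?F. card (?X f))"
  proof (rule card_UN_disjoint)
    show "finite ?F" by (rule finite_subset[OF _ finite_polys_of_degree[of n]]) blast
    show "\<forall>f\<in>?F. finite (?X f)" by (intro ballI finite_subset[OF _ finite_carrier_mat[of n n]]) blast
  qed blast
  ultimately have "cGL T n = (\<Sum>f\<in>?F. real (card (?X f)) / real (card (GL_set n :: 'a mat set)))"
    unfolding cGL_def by (simp add: sum_divide_distrib)
  also have "\<dots> = (\<Sum>f\<in>?F. 1 / real (poly_totient f))"
  proof (rule sum.cong[OF refl])
    fix f assume "f \<in> ?F"
    then have f: "monic f" "degree f = n" "f \<noteq> 0" by auto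
    have "real (card (?X f)) * real (poly_totient f) = real (card (GL_set n :: 'a mat set))"
      using arg_cong[OF card_cyclic_GL_char_poly[OF f(1,2)], of real] by (simp only: of_nat_mult)
    then show "real (card (?X f)) / real (card (GL_set n :: 'a mat set)) = 1 / real (poly_totient f)"
      using pos poly_totient_pos[OF f(3)] by (simp add: field_simps)
  qed
  finally show ?thesis .
qed

lemma cA_eq_sum:
  fixes T :: "'a :: {finite,field} itself"
  shows "cA T m = (\<Sum>f | monic f \<and> degree f = Suc m \<and> poly f 0 \<noteq> 0 \<and> poly f 1 = 0.
    (real CARD('a) - 1) / real (poly_totient (f :: 'a poly)))"
proof -
  let ?F = "{f :: 'a poly. monic f \<and> degree f = Suc m \<and> poly f 0 \<noteq> 0 \<and> poly f 1 = 0}"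
  let ?e = "unit_vec (Suc m) 0 :: 'a vec"
  let ?X = "\<lambda>f. {A \<in> carrier_mat (Suc m) (Suc m). A *\<^sub>v ?e = ?e \<and> cyclic_mat A \<and> char_poly A = (f :: 'a poly)}"
  have fin: "finite (A_set m :: 'a mat set)"
    by (rule finite_subset[OF _ finite_carrier_mat[of "Suc m" "Suc m"]]) (auto simp: A_set_iff GL_set_iff)
  have "1\<^sub>m (Suc m) \<in> (A_set m :: 'a mat set)" by (simp add: A_set_iff GL_set_iff)
  then have pos: "card (A_set m :: 'a mat set) > 0" using fin card_gt_0_iff by blast
  \<comment> \<open>Fixing \<open>?e\<close> makes 1 an eigenvalue, which is the origin of the
    condition \<open>poly f 1 = 0\<close>.\<close>
  have root: "poly (char_poly A) 1 = 0" if A: "A \<in> carrier_mat (Suc m) (Suc m)" "A *\<^sub>v ?e = ?e" for A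
  proof -
    have "eigenvector A ?e 1" unfolding eigenvector_def carrier_matD(1)[OF A(1)] A(2) by simp
    then show ?thesis using eigenvalue_root_char_poly[OF A(1)] unfolding eigenvalue_def by blast
  qed
  have deg: "monic (char_poly A)" "degree (char_poly A) = Suc m"
    if "A \<in> carrier_mat (Suc m) (Suc m)" for A :: "'a mat"
    using degree_monic_char_poly[OF that] by simp_all
  have "{x \<in> (A_set m :: 'a mat set). cyclic_mat x} = (\<Union>f\<in>?F. ?X f)"
    using det_eq_0_iff_char_poly deg root by (auto simp: A_set_iff GL_set_iff)
  moreover have "card (\<Union>f\<in>?F. ?X f) = (\<Sum>f\<in>?F. card (?X f))"
  proof (rule card_UN_disjoint)
    show "finite ?F" by (rule finite_subset[OF _ finite_polys_of_degree[of "Suc m"]]) blast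
    show "\<forall>f\<in>?F. finite (?X f)"
      by (intro ballI finite_subset[OF _ finite_carrier_mat[of "Suc m" "Suc m"]]) blast
  qed blast
  ultimately have "cA T m = (\<Sum>f\<in>?F. real (card (?X f)) / real (card (A_set m :: 'a mat set)))"
    unfolding cA_def by (simp add: sum_divide_distrib)
  also have "\<dots> = (\<Sum>f\<in>?F. (real CARD('a) - 1) / real (poly_totient f))"
  proof (rule sum.cong[OF refl])
    fix f assume "f \<in> ?F"
    then have f: "monic f" "degree f = Suc m" "poly f 1 = 0" "f \<noteq> 0" by auto
    have "real (card (?X f)) * real (poly_totient f) = real (CARD('a) - 1) * real (card (A_set m :: 'a mat set))"
      using arg_cong[OF card_cyclic_A_char_poly[OF f(1-3)], of real] by (simp only: of_nat_mult)
    moreover have "real (CARD('a) - 1) = real CARD('a) - 1"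
      using card_field_ge_2[where 'a = 'a] by (simp add: of_nat_diff)
    ultimately show "real (card (?X f)) / real (card (A_set m :: 'a mat set)) =
        (real CARD('a) - 1) / real (poly_totient f)"
      using pos poly_totient_pos[OF f(4)] by (simp add: field_simps)
  qed
  finally show ?thesis .
qed

section \<open>The generating functions\<close>

lemma irreducible_linear_poly: "irreducible [:a, 1 :: 'a :: field:]"
proof (rule irreducibleI)
  fix b c :: "'a poly" assume bc: "[:a, 1:] = b * c"
  then have "b \<noteq> 0" "c \<noteq> 0" by auto
  moreover from this have "degree b + degree c = 1"
    using arg_cong[OF bc, of degree] by (simp add: degree_mult_eq)
  ultimately show "is_unit b \<or> is_unit c" by (auto simp: is_unit_iff_degree add_is_1)
qed (simp_all add: is_unit_iff_degree)

text \<open>\<open>D\<close> truncates the infinite product and \<open>Z\<close> lists forbidden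
  roots: \<open>{0}\<close> for invertible matrices, \<open>{0, 1}\<close> for the part of the
  product common to both series.\<close>

definition irred_polys :: "nat \<Rightarrow> 'a :: field set \<Rightarrow> 'a poly set" where
  "irred_polys D Z = {p. monic p \<and> irreducible p \<and> degree p \<le> D \<and> (\<forall>a\<in>Z. p \<noteq> [:- a, 1:])}"

lemma finite_irred_polys: "finite (irred_polys D (Z :: 'a :: {finite,field} set))"
  by (rule finite_subset[OF _ finite_polys_degree_le[of D]]) (auto simp: irred_polys_def)

text \<open>Divisors of \<open>f\<close> have degree at most \<open>n\<close>, so the truncation at
  \<open>D\<close> is not felt; and excluding the prime \<open>[:- a, 1:]\<close> means excluding
  the root \<open>a\<close>.\<close>

lemma monic_polys_supported_irred_polys:
  fixes Z :: "'a :: field set"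
  assumes "n \<le> D"
  shows "monic_polys_supported (irred_polys D Z) n =
    {f. monic f \<and> degree f = n \<and> (\<forall>a\<in>Z. poly f a \<noteq> 0)}"
proof (intro equalityI subsetI)
  fix f assume f: "f \<in> monic_polys_supported (irred_polys D Z) n"
  have "poly f a \<noteq> 0" if "a \<in> Z" for a
  proof
    assume "poly f a = 0"
    then have "[:- a, 1:] dvd f" by (simp add: poly_eq_0_iff_dvd)
    then have "[:- a, 1:] \<in> irred_polys D Z"
      using f irreducible_linear_poly[of "- a"] by (simp add: monic_polys_supported_def)
    then show False using that unfolding irred_polys_def by blast
  qed
  then show "f \<in> {f. monic f \<and> degree f = n \<and> (\<forall>a\<in>Z. poly f a \<noteq> 0)}"
    using f unfolding monic_polys_supported_def by blast
next
  fix f assume "f \<in> {f. monic f \<and> degree f = n \<and> (\<forall>a\<in>Z. poly f a \<noteq> 0)}"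
  then have f: "monic f" "degree f = n" "\<And>a. a \<in> Z \<Longrightarrow> poly f a \<noteq> 0" "f \<noteq> 0" by auto
  have "p \<in> irred_polys D Z" if p: "monic p" "irreducible p" "p dvd f" for p
  proof -
    have "degree p \<le> D" using dvd_imp_degree_le[OF p(3) f(4)] f(2) assms by simp
    moreover have "p \<noteq> [:- a, 1:]" if "a \<in> Z" for a
      using p(3) f(3)[OF that] by (auto simp: poly_eq_0_iff_dvd)
    ultimately show ?thesis using p by (simp add: irred_polys_def)
  qed
  then show "f \<in> monic_polys_supported (irred_polys D Z) n"
    using f by (simp add: monic_polys_supported_def)
qed

text \<open>For \<open>d = 1\<close> the monic linear polynomials are indexed by their roots and
  lose the roots 0 and 1; in higher degree nothing is lost.\<close>

lemma card_irred_polys_degree: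
  fixes T :: "'a :: {finite,field} itself"
  assumes "d \<in> {1..D}"
  shows "card {p \<in> irred_polys D {0, 1 :: 'a}. degree p = d} = Nirr' T d"
proof (cases "d = 1")
  case True
  have "{p \<in> irred_polys D {0, 1 :: 'a}. degree p = d} = (\<lambda>a. [:- a, 1:]) ` (UNIV - {0, 1})"
  proof (intro equalityI subsetI)
    fix p :: "'a poly" assume p: "p \<in> {p \<in> irred_polys D {0, 1}. degree p = d}"
    then have "degree p = 1" using True by simp
    then obtain a b where "p = [:a, b:]" using degree1_coeffs by blast
    then have ab: "p = [:a, 1:]" using p True by (auto simp: irred_polys_def)
    moreover have "a \<noteq> 0" "a \<noteq> - 1" using p ab by (auto simp: irred_polys_def)
    ultimately show "p \<in> (\<lambda>a. [:- a, 1:]) ` (UNIV - {0, 1})"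
      by (intro image_eqI[of _ _ "- a"]) (auto simp: minus_equation_iff[of a])
  next
    fix p :: "'a poly" assume "p \<in> (\<lambda>a. [:- a, 1:]) ` (UNIV - {0, 1})"
    then obtain a where "p = [:- a, 1:]" "a \<noteq> 0" "a \<noteq> 1" by auto
    then show "p \<in> {p \<in> irred_polys D {0, 1}. degree p = d}"
      using True assms irreducible_linear_poly[of "- a"] by (auto simp: irred_polys_def)
  qed
  then have "card {p \<in> irred_polys D {0, 1 :: 'a}. degree p = d} = card (UNIV - {0, 1 :: 'a})"
    by (simp add: card_image inj_on_def)
  also have "\<dots> = CARD('a) - 2" by (subst card_Diff_subset) auto
  finally show ?thesis using True by (simp add: Nirr'_def)
next
  case False
  have "{p \<in> irred_polys D {0, 1 :: 'a}. degree p = d} = {p. monic p \<and> irreducible p \<and> degree p = d}"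
    using False assms by (auto simp: irred_polys_def)
  then show ?thesis using False by (simp add: Nirr'_def Nirr_def)
qed

lemma prod_irred_polys_nth:
  fixes Z :: "'a :: {finite,field} set"
  assumes "n \<le> D"
  shows "fps_nth (\<Prod>p\<in>irred_polys D Z. euler_factor p) n =
    (\<Sum>f | monic f \<and> degree f = n \<and> (\<forall>a\<in>Z. poly f a \<noteq> 0). 1 / real (poly_totient f))"
proof -
  have "monic p \<and> irreducible p" if "p \<in> irred_polys D Z" for p
    using that unfolding irred_polys_def by blast
  from prod_euler_factor_nth[OF finite_irred_polys this] show ?thesis
    by (simp only: monic_polys_supported_irred_polys[OF assms])
qed

text \<open>The infinite product is the limit of partial products in the topology of formal power
  series; it suffices that each coefficient is eventually constant.\<close>

theorem theorem5p5:
  fixes T :: "'a :: {finite,field} itself"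
  defines "q \<equiv> real (card (UNIV :: 'a set))"
  shows "((\<lambda>D. inverse (1 - fps_const (1/q) * fps_X) *
             (\<Prod>d\<in>{1..D}. (1 + fps_X ^ d *
                 inverse (fps_const (q ^ d - 1) * (1 - fps_const (1 / q ^ d) * fps_X ^ d)))
               ^ Nirr' T d))
           \<longlonglongrightarrow> CA T) \<and>
         CA T = inverse (1 - fps_const (1/q) * fps_X) *
                inverse (1 + fps_X * inverse (fps_const (q - 1) * (1 - fps_const (1/q) * fps_X))) *
                CGL T"
proof -
  define W :: "real fps" where "W = 1 - fps_const (1 / q) * fps_X"
  define H where "H D = (\<Prod>p\<in>irred_polys D {0, 1 :: 'a}. euler_factor p)" for D
  define l :: "'a poly" where "l = [:- 1, 1:]"
  define E where "E = euler_factor l"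
  have q: "q > 1" using card_field_ge_2[where 'a = 'a] by (simp add: q_def)
  have l: "irreducible l" "monic l" "degree l = 1"
    using irreducible_linear_poly[of "- 1 :: 'a"] by (simp_all add: l_def)
  have E: "E = 1 + fps_X * inverse (fps_const (q - 1) * W)"
    unfolding E_def euler_factor_eq[OF l(1)] l(3) W_def q_def by simp
  have prodH: "(\<Prod>d\<in>{1..D}. (1 + fps_X ^ d *
      inverse (fps_const (q ^ d - 1) * (1 - fps_const (1 / q ^ d) * fps_X ^ d))) ^ Nirr' T d) = H D" for D
  proof -
    have "H D = (\<Prod>d\<in>{1..D}. \<Prod>p\<in>{p \<in> irred_polys D {0, 1 :: 'a}. degree p = d}. euler_factor p)"
      unfolding H_def
    proof (rule prod.group[symmetric])
      show "degree ` irred_polys D {0, 1 :: 'a} \<subseteq> {1..D}"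
        using irreducible_degree_pos by (force simp: irred_polys_def)
    qed (simp_all add: finite_irred_polys)
    also have "\<dots> = (\<Prod>d\<in>{1..D}. (1 + fps_X ^ d *
      inverse (fps_const (q ^ d - 1) * (1 - fps_const (1 / q ^ d) * fps_X ^ d))) ^ Nirr' T d)"
    proof (rule prod.cong[OF refl])
      fix d assume d: "d \<in> {1..D}"
      have "(\<Prod>p\<in>{p \<in> irred_polys D {0, 1 :: 'a}. degree p = d}. euler_factor p) =
        (\<Prod>p\<in>{p \<in> irred_polys D {0, 1 :: 'a}. degree p = d}. 1 + fps_X ^ d *
          inverse (fps_const (q ^ d - 1) * (1 - fps_const (1 / q ^ d) * fps_X ^ d)))"
        by (rule prod.cong[OF refl]) (auto simp: irred_polys_def euler_factor_eq q_def)
      then show "(\<Prod>p\<in>{p \<in> irred_polys D {0, 1 :: 'a}. degree p = d}. euler_factor p) =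
        (1 + fps_X ^ d * inverse (fps_const (q ^ d - 1) * (1 - fps_const (1 / q ^ d) * fps_X ^ d))) ^ Nirr' T d"
        by (simp only: prod_constant card_irred_polys_degree[OF d, of T])
    qed
    finally show ?thesis by simp
  qed
  have Hnth: "fps_nth (H D) n =
      (\<Sum>f | monic f \<and> degree f = n \<and> poly f 0 \<noteq> 0 \<and> poly f 1 \<noteq> 0. 1 / real (poly_totient (f :: 'a poly)))"
    if "n \<le> D" for n D
    unfolding H_def prod_irred_polys_nth[OF that] by simp
  \<comment> \<open>Restoring \<open>l\<close> lifts the ban on the root 1. It has degree 1, so it
    survives the truncation only for \<open>D >= 1\<close>.\<close>
  have EH: "E * H D = (\<Prod>p\<in>irred_polys D {0 :: 'a}. euler_factor p)" if "D \<ge> 1" for D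
  proof -
    have "irred_polys D {0 :: 'a} = insert l (irred_polys D {0, 1})"
      using l that by (auto simp: irred_polys_def l_def)
    moreover have "l \<notin> irred_polys D {0, 1}" by (simp add: irred_polys_def l_def)
    ultimately show ?thesis by (simp add: H_def E_def finite_irred_polys)
  qed
  have EHnth: "fps_nth (E * H D) n =
      (\<Sum>f | monic f \<and> degree f = n \<and> poly f 0 \<noteq> 0. 1 / real (poly_totient (f :: 'a poly)))"
    if "n \<le> D" "D \<ge> 1" for n D
    unfolding EH[OF that(2)] prod_irred_polys_nth[OF that(1)] by simp
  have cGL: "cGL T n = fps_nth (E * H D) n" if "n \<le> D" "D \<ge> 1" for n D
    unfolding EHnth[OF that] cGL_eq_sum ..
  \<comment> \<open>The polynomials with root 1 are counted as a difference: \<open>E * H D\<close>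
    allows the root, \<open>H D\<close> forbids it. They have degree \<open>Suc n\<close>, hence the
    bound on \<open>D\<close>, and the factor \<open>fps_X\<close> in \<open>E - 1\<close> brings
    the index back to \<open>n\<close>.\<close>
  have cA: "cA T n = fps_nth (inverse W * H D) n" if D: "Suc n \<le> D" for n D
  proof -
    let ?F = "{f :: 'a poly. monic f \<and> degree f = Suc n \<and> poly f 0 \<noteq> 0}"
    let ?FZ = "{f :: 'a poly. monic f \<and> degree f = Suc n \<and> poly f 0 \<noteq> 0 \<and> poly f 1 = 0}"
    let ?FN = "{f :: 'a poly. monic f \<and> degree f = Suc n \<and> poly f 0 \<noteq> 0 \<and> poly f 1 \<noteq> 0}"
    have fin: "finite ?F" by (rule finite_subset[OF _ finite_polys_of_degree[of "Suc n"]]) auto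
    have "?F = ?FZ \<union> ?FN" by blast
    then have "(\<Sum>f\<in>?F. 1 / real (poly_totient f)) =
        (\<Sum>f\<in>?FZ \<union> ?FN. 1 / real (poly_totient f))" by simp
    also have "\<dots> = (\<Sum>f\<in>?FZ. 1 / real (poly_totient f)) + (\<Sum>f\<in>?FN. 1 / real (poly_totient f))"
      by (rule sum.union_disjoint) (rule finite_subset[OF _ fin], blast | blast)+
    finally have "(\<Sum>f\<in>?FZ. 1 / real (poly_totient f)) = fps_nth (E * H D - H D) (Suc n)"
      using D by (simp add: EHnth Hnth)
    moreover have "cA T n = (q - 1) * (\<Sum>f\<in>?FZ. 1 / real (poly_totient f))"
      unfolding cA_eq_sum q_def sum_distrib_left by simp
    ultimately have "cA T n = (q - 1) * fps_nth (E * H D - H D) (Suc n)" by (simp only:)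
    also have "\<dots> = fps_nth (fps_const (q - 1) * (E * H D - H D)) (Suc n)" by simp
    also have "fps_const (q - 1) * (E * H D - H D) = fps_X * (inverse W * H D)"
    proof -
      have "inverse (fps_const (q - 1) * W) = fps_const (inverse (q - 1)) * inverse W"
        by (simp add: fps_inverse_mult fps_const_inverse)
      then have "fps_const (q - 1) * (E * H D - H D) =
          (fps_const (q - 1) * fps_const (inverse (q - 1))) * (fps_X * (inverse W * H D))"
        unfolding E by (simp only: algebra_simps) simp
      also have "fps_const (q - 1) * fps_const (inverse (q - 1)) = 1"
        using q by (simp add: fps_const_mult)
      finally show ?thesis by simp
    qed
    also have "fps_nth (fps_X * (inverse W * H D)) (Suc n) = fps_nth (inverse W * H D) n" by simp
    finally show ?thesis .
  qed
  have "(\<lambda>D. inverse W * H D) \<longlonglongrightarrow> CA T"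
  proof (rule tendsto_fpsI)
    fix n
    show "eventually (\<lambda>D. fps_nth (inverse W * H D) n = fps_nth (CA T) n) sequentially"
      using eventually_ge_at_top[of "Suc n"] by eventually_elim (simp add: CA_def cA)
  qed
  moreover have "CA T = inverse W * inverse E * CGL T"
  proof (rule fps_ext)
    fix n
    have "fps_nth E 0 = 1" unfolding E by simp
    then have inv: "inverse E * E = 1" by (intro inverse_mult_eq_1) simp
    \<comment> \<open>Coefficient \<open>n\<close> of a product sees only coefficients up to
      \<open>n\<close> of \<open>CGL T\<close>, where it agrees with \<open>E * H (Suc n)\<close>.
      The cutoff \<open>Suc n\<close> meets the bounds of both \<open>cGL\<close> and
      \<open>cA\<close>.\<close>
    have "fps_nth (inverse W * inverse E * CGL T) n =
        fps_nth (inverse W * inverse E * (E * H (Suc n))) n"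
      unfolding fps_mult_nth[of "inverse W * inverse E"]
      by (intro sum.cong refl) (simp add: CGL_def cGL[of _ "Suc n"])
    also have "inverse W * inverse E * (E * H (Suc n)) = inverse W * (inverse E * E) * H (Suc n)"
      by (simp only: mult.assoc)
    also have "fps_nth \<dots> n = cA T n" unfolding inv by (simp add: cA[of n "Suc n"])
    finally show "fps_nth (CA T) n = fps_nth (inverse W * inverse E * CGL T) n" by (simp add: CA_def)
  qed
  ultimately show ?thesis unfolding prodH E W_def by blast
qed

end
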